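(* Let $n\ge 1$, let $R$ be a real linear operator on $\mathbb{C}^n$, let $p(\lambda,\overline\lambda)=\sum_{i,j=0}^{n}h_{ij}\lambda^j\overline\lambda^i$ be its characteristic polynomial, and let $H=[h_{ij}]_{i,j=0}^n\in\mathbb{C}^{(n+1)\times(n+1)}$ be its coefficient matrix. Then the following hold. (i) $p$ is real valued, i.e. $p(\lambda,\overline\lambda)\in\mathbb{R}$ for all $\lambda\in\mathbb{C}$. (ii) $H$ is Hermitian. (iii) Let $U=[u_{ij}]_{i,j=0}^n\in\mathbb{C}^{(n+1)\times(n+1)}$ be unitary such that $UHU^*$ is diagonal. Then $p$ can be cast in the form $$p(\lambda,\overline\lambda)=\sum_{i=0}^n d_i|p_i(\lambda)|^2,$$ where $d_i\in\mathbb{R}$ and $p_i(\lambda)=\sum_{j=0}^n u_{ij}\lambda^j$ for $i=0,1,\dots,n$. The polynomials $p_0,\dots,p_n$ have no common zeros. (iv) If $H$ is positive definite, then $p$ can be cast in the form $p(\lambda,\overline\lambda)=\sum_{i=0}^n|p_i(\lambda)|^2$, where each $p_i$ is a complex polynomial of degree $i$. These polynomials $p_i$ have no common zeros, and consequently $\sigma(R)=\emptyset$. (v) If $\det R^{\mathbb{C}}\le 0$, then $p(\lambda,\overline\lambda)$ has a zero $\lambda\in\mathbb{C}$, and consequently $\sigma(R)\neq\emptyset$. (vi) For the adjoint $R^*$, the characteristic polynomial $p_{R^*}$ of $R^*$ satisfies $p_{R^*}(\lambda,\overline\lambda)=p(\overline\lambda,\lambda)$ for all $\lambda\in\mathbb{C}$,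 i.e. the coefficients of $p_{R^*}$ are the complex conjugates of those of $p$. In particular, the characteristic polynomial of a self-adjoint operator ($R^*=R$) has real coefficients.
   Context: A map $R:\mathbb{C}^n\to\mathbb{C}^n$ is real linear if it is additive and $R(rx)=rRx$ for $r\in\mathbb{R}$. Every such $R$ is represented uniquely as $R=C+B\tau$ with $C,B\in\mathbb{C}^{n\times n}$, where $\tau z=\overline z$ is componentwise complex conjugation. Its complexification is the matrix $$R^{\mathbb{C}}=\begin{bmatrix} C & B\\ \overline B & \overline C\end{bmatrix}\in\mathbb{C}^{2n\times 2n},$$ where the bar denotes entrywise conjugation. For $\lambda\in\mathbb{C}$, $R-\lambda$ is the real linear map $x\mapsto Rx-\lambda x$. The characteristic polynomial of $R$ is $$p(\lambda,\overline\lambda)=\det (R-\lambda)^{\mathbb{C}}=\det\begin{bmatrix} C-\lambda & B\\ \overline B & \overline{C-\lambda}\end{bmatrix}.$$ It is a polynomial in $\lambda$ and $\overline\lambda$ of degree at most $n$ in each, so it can be written uniquely as $\sum_{i,j=0}^n h_{ij}\lambda^j\overline\lambda^i$; $H=[h_{ij}]_{i,j=0}^n$ is called its coefficient matrix. The notation $p(\overline\lambda,\lambda)$ means the value obtained by replacing $\lambda$ by $\overline\lambda$ (and $\overline\lambda$ by $\lambda$). The spectrum $\sigma(R)$ is the set of $\lambda\in\mathbb{C}$ for which $R-\lambda$ is not invertible. The adjoint of $R=C+B\tau$ is $R^*=C^*+B^T\tau$ (the adjoint with respect to the real inner product $\operatorname{Re}(x,y)$). *)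

theory Defs
  imports "Jordan_Normal_Form.Schur_Decomposition"
begin

text \<open>Complex n-space is the carrier set \<open>carrier_vec n\<close>. Operators are total functions on vectors,
  and only their values on that carrier matter.\<close>

definition real_linear_op :: "nat \<Rightarrow> (complex vec \<Rightarrow> complex vec) \<Rightarrow> bool" where
  "real_linear_op n R \<longleftrightarrow>
     (\<forall>x \<in> carrier_vec n. R x \<in> carrier_vec n) \<and>
     (\<forall>x \<in> carrier_vec n. \<forall>y \<in> carrier_vec n. R (x + y) = R x + R y) \<and>
     (\<forall>r::real. \<forall>x \<in> carrier_vec n. R (complex_of_real r \<cdot>\<^sub>v x) = complex_of_real r \<cdot>\<^sub>v R x)"

definition represents :: "nat \<Rightarrow> (complex vec \<Rightarrow> complex vec) \<Rightarrow> complex mat \<Rightarrow> complex mat \<Rightarrow> bool" where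
  "represents n R C B \<longleftrightarrow> C \<in> carrier_mat n n \<and> B \<in> carrier_mat n n \<and>
     (\<forall>x \<in> carrier_vec n. R x = C *\<^sub>v x + B *\<^sub>v conjugate x)"

definition linear_part :: "nat \<Rightarrow> (complex vec \<Rightarrow> complex vec) \<Rightarrow> complex mat" where
  "linear_part n R = fst (THE (C, B). represents n R C B)"

definition antilinear_part :: "nat \<Rightarrow> (complex vec \<Rightarrow> complex vec) \<Rightarrow> complex mat" where
  "antilinear_part n R = snd (THE (C, B). represents n R C B)"

definition complexification :: "nat \<Rightarrow> (complex vec \<Rightarrow> complex vec) \<Rightarrow> complex mat" where
  "complexification n R =
     (let C = linear_part n R; B = antilinear_part n R
      in four_block_mat C B (map_mat cnj B) (map_mat cnj C))"

definition op_shift :: "(complex vec \<Rightarrow> complex vec) \<Rightarrow> complex \<Rightarrow> complex vec \<Rightarrow> complex vec" where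
  "op_shift R \<mu> = (\<lambda>x. R x - \<mu> \<cdot>\<^sub>v x)"

text \<open>The adjoint is given by its representation. Lemma \<open>op_adjoint_Re\<close> below shows that it is the
  adjoint with respect to the real inner product.\<close>

definition op_adjoint :: "nat \<Rightarrow> (complex vec \<Rightarrow> complex vec) \<Rightarrow> complex vec \<Rightarrow> complex vec" where
  "op_adjoint n R = (\<lambda>x. mat_adjoint (linear_part n R) *\<^sub>v x
                        + transpose_mat (antilinear_part n R) *\<^sub>v conjugate x)"

definition op_spectrum :: "nat \<Rightarrow> (complex vec \<Rightarrow> complex vec) \<Rightarrow> complex set" where
  "op_spectrum n R = {\<mu>. \<not> bij_betw (op_shift R \<mu>) (carrier_vec n) (carrier_vec n)}"

text \<open>\<open>op_charpoly n R \<mu>\<close> is $p(\mu,\overline\mu)$. Hence $p(\overline\mu,\mu)$, where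
  the two arguments are interchanged, is \<open>op_charpoly n R (cnj \<mu>)\<close>.\<close>

definition op_charpoly :: "nat \<Rightarrow> (complex vec \<Rightarrow> complex vec) \<Rightarrow> complex \<Rightarrow> complex" where
  "op_charpoly n R \<mu> = det (complexification n (op_shift R \<mu>))"

definition is_coeff_matrix :: "nat \<Rightarrow> (complex \<Rightarrow> complex) \<Rightarrow> complex mat \<Rightarrow> bool" where
  "is_coeff_matrix n p H \<longleftrightarrow> H \<in> carrier_mat (n + 1) (n + 1) \<and>
     (\<forall>\<mu>. p \<mu> = (\<Sum>i\<le>n. \<Sum>j\<le>n. H $$ (i, j) * \<mu> ^ j * cnj \<mu> ^ i))"

definition charpoly_coeffs :: "nat \<Rightarrow> (complex vec \<Rightarrow> complex vec) \<Rightarrow> complex mat" where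
  "charpoly_coeffs n R = (THE H. is_coeff_matrix n (op_charpoly n R) H)"

definition hermitian_mat :: "complex mat \<Rightarrow> bool" where
  "hermitian_mat H \<longleftrightarrow> square_mat H \<and> mat_adjoint H = H"

definition unitary_mat :: "complex mat \<Rightarrow> bool" where
  "unitary_mat U \<longleftrightarrow>
     square_mat U \<and> inverts_mat U (mat_adjoint U) \<and> inverts_mat (mat_adjoint U) U"

text \<open>The order on the complex numbers is that of \<open>HOL-Library.Complex_Order\<close>: \<open>0 < z\<close> says that
  \<open>z\<close> is real and positive, and \<open>z \<le> 0\<close> that it is real and not positive.\<close>

definition pos_def_mat :: "complex mat \<Rightarrow> bool" where
  "pos_def_mat H \<longleftrightarrow> hermitian_mat H \<and>
     (\<forall>x \<in> carrier_vec (dim_row H). x \<noteq> 0\<^sub>v (dim_row H) \<longrightarrow> 0 < (H *\<^sub>v x) \<bullet>c x)"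

definition row_poly :: "complex mat \<Rightarrow> nat \<Rightarrow> complex poly" where
  "row_poly U i = (\<Sum>j<dim_col U. monom (U $$ (i, j)) j)"

lemma represents_ex:
  assumes "real_linear_op n R"
  shows "\<exists>C B. represents n R C B"
proof -
  have clos: "\<And>x. x \<in> carrier_vec n \<Longrightarrow> R x \<in> carrier_vec n"
    and add: "\<And>x y. x \<in> carrier_vec n \<Longrightarrow> y \<in> carrier_vec n \<Longrightarrow> R (x + y) = R x + R y"
    and sc: "\<And>r x. x \<in> carrier_vec n \<Longrightarrow> R (complex_of_real r \<cdot>\<^sub>v x) = complex_of_real r \<cdot>\<^sub>v R x"
    using assms unfolding real_linear_op_def by auto
  define e :: "nat \<Rightarrow> complex vec" where "e = unit_vec n"
  define C where "C = mat n n (\<lambda>(r, j). (R (e j) $ r - \<i> * R (\<i> \<cdot>\<^sub>v e j) $ r) / 2)"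
  define B where "B = mat n n (\<lambda>(r, j). (R (e j) $ r + \<i> * R (\<i> \<cdot>\<^sub>v e j) $ r) / 2)"
  have e: "\<And>j. e j \<in> carrier_vec n" "\<And>j. \<i> \<cdot>\<^sub>v e j \<in> carrier_vec n" unfolding e_def by auto
  have part: "R (vec n (\<lambda>i. if i < k then x $ i else 0)) =
      vec n (\<lambda>r. \<Sum>j<k. C $$ (r, j) * x $ j + B $$ (r, j) * cnj (x $ j))"
    if "x \<in> carrier_vec n" "k \<le> n" for x k
    using that(2)
  proof (induction k)
    case 0
    have "vec n (\<lambda>i. 0) = (0\<^sub>v n :: complex vec)" by auto
    moreover have "R (0\<^sub>v n) = 0\<^sub>v n"
      using sc[of "0\<^sub>v n" 0] clos[of "0\<^sub>v n"] by (auto simp: smult_vec_def zero_vec_def)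
    ultimately show ?case by auto
  next
    case (Suc k)
    let ?v = "vec n (\<lambda>i. if i < k then x $ i else 0)"
    let ?a = "complex_of_real (Re (x $ k)) \<cdot>\<^sub>v e k"
    let ?b = "complex_of_real (Im (x $ k)) \<cdot>\<^sub>v (\<i> \<cdot>\<^sub>v e k)"
    have split: "vec n (\<lambda>i. if i < Suc k then x $ i else 0) = ?v + (?a + ?b)"
    proof (rule eq_vecI)
      fix i assume "i < dim_vec (?v + (?a + ?b))"
      then have i: "i < n" unfolding e_def by auto
      have "x $ k = complex_of_real (Re (x $ k)) + \<i> * complex_of_real (Im (x $ k))"
        using complex_eq by blast
      then show "vec n (\<lambda>i. if i < Suc k then x $ i else 0) $ i = (?v + (?a + ?b)) $ i"
        using i Suc.prems unfolding e_def by (auto simp: less_Suc_eq mult.commute)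
    qed (auto simp: e_def)
    have "R (?v + (?a + ?b)) = R ?v + (R ?a + R ?b)"
      using e add[of ?v "?a + ?b"] add[of ?a ?b] by simp
    also have "\<dots> = R ?v + (complex_of_real (Re (x $ k)) \<cdot>\<^sub>v R (e k)
        + complex_of_real (Im (x $ k)) \<cdot>\<^sub>v R (\<i> \<cdot>\<^sub>v e k))"
      using sc e by auto
    also have "\<dots> = vec n (\<lambda>r. \<Sum>j<Suc k. C $$ (r, j) * x $ j + B $$ (r, j) * cnj (x $ j))"
    proof (rule eq_vecI)
      fix r assume "r < dim_vec (vec n (\<lambda>r. \<Sum>j<Suc k. C $$ (r, j) * x $ j + B $$ (r, j) * cnj (x $ j)))"
      then have r: "r < n" by auto
      have d: "dim_vec (R (e k)) = n" "dim_vec (R (\<i> \<cdot>\<^sub>v e k)) = n" using clos e by auto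
      have "C $$ (r, k) * x $ k + B $$ (r, k) * cnj (x $ k) =
        complex_of_real (Re (x $ k)) * R (e k) $ r + complex_of_real (Im (x $ k)) * R (\<i> \<cdot>\<^sub>v e k) $ r"
        using r Suc.prems unfolding C_def B_def
        by (auto simp: complex_eq_iff field_simps)
      then show "(R ?v + (complex_of_real (Re (x $ k)) \<cdot>\<^sub>v R (e k)
        + complex_of_real (Im (x $ k)) \<cdot>\<^sub>v R (\<i> \<cdot>\<^sub>v e k))) $ r =
        vec n (\<lambda>r. \<Sum>j<Suc k. C $$ (r, j) * x $ j + B $$ (r, j) * cnj (x $ j)) $ r"
        using r d Suc by auto
    qed (use clos e in auto)
    finally show ?case using split by simp
  qed
  have "represents n R C B"
    unfolding represents_def
  proof (intro conjI ballI)
    show CB: "C \<in> carrier_mat n n" "B \<in> carrier_mat n n" unfolding C_def B_def by auto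
    fix x :: "complex vec" assume x: "x \<in> carrier_vec n"
    have "vec n (\<lambda>i. if i < n then x $ i else 0) = x" using x by auto
    then have "R x = vec n (\<lambda>r. \<Sum>j<n. C $$ (r, j) * x $ j + B $$ (r, j) * cnj (x $ j))"
      using part[OF x, of n] by simp
    also have "\<dots> = C *\<^sub>v x + B *\<^sub>v conjugate x"
      using CB x by (auto simp: scalar_prod_def sum.distrib lessThan_atLeast0)
    finally show "R x = C *\<^sub>v x + B *\<^sub>v conjugate x" .
  qed
  then show ?thesis by blast
qed

lemma represents_unique:
  assumes "represents n R C B" and "represents n R C' B'"
  shows "C = C' \<and> B = B'"
proof -
  have c: "C \<in> carrier_mat n n" "B \<in> carrier_mat n n" "C' \<in> carrier_mat n n" "B' \<in> carrier_mat n n"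
    using assms unfolding represents_def by auto
  have entry: "C $$ (r, j) = C' $$ (r, j) \<and> B $$ (r, j) = B' $$ (r, j)" if "r < n" "j < n" for r j
  proof -
    have eq: "C *\<^sub>v x + B *\<^sub>v conjugate x = C' *\<^sub>v x + B' *\<^sub>v conjugate x" if "x \<in> carrier_vec n" for x
      using assms that unfolding represents_def by metis
    have ap: "(M *\<^sub>v x + N *\<^sub>v conjugate x) $ r = M $$ (r, j) * a + N $$ (r, j) * cnj a"
      if "M \<in> carrier_mat n n" "N \<in> carrier_mat n n" "x = a \<cdot>\<^sub>v unit_vec n j" for M N :: "complex mat" and x a
    proof -
      have "conjugate x = cnj a \<cdot>\<^sub>v unit_vec n j" using that(3) \<open>j < n\<close> by auto
      then show ?thesis using that \<open>j < n\<close> \<open>r < n\<close> by (auto simp: mult.commute)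
    qed
    have "C $$ (r, j) * a + B $$ (r, j) * cnj a = C' $$ (r, j) * a + B' $$ (r, j) * cnj a" for a
      using eq[of "a \<cdot>\<^sub>v unit_vec n j"] ap[OF c(1,2) refl, of a] ap[OF c(3,4) refl, of a] by simp
    from this[of 1] this[of \<i>] show ?thesis by (auto simp: complex_eq_iff)
  qed
  show ?thesis using c entry by auto
qed

lemma parts_eqI:
  assumes "represents n R C B"
  shows "linear_part n R = C" "antilinear_part n R = B"
proof -
  have "(THE (C, B). represents n R C B) = (C, B)"
  proof (rule the_equality)
    fix p assume "case p of (C, B) \<Rightarrow> represents n R C B"
    then show "p = (C, B)" using represents_unique[OF assms] by (cases p) auto
  qed (use assms in simp)
  then show "linear_part n R = C" "antilinear_part n R = B"
    unfolding linear_part_def antilinear_part_def by auto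
qed

lemma represents_parts:
  "real_linear_op n R \<Longrightarrow> represents n R (linear_part n R) (antilinear_part n R)"
  using represents_ex[of n R] parts_eqI[of n R] by auto

lemma mat_adjoint_index:
  assumes "i < dim_col A" "j < dim_row A"
  shows "mat_adjoint A $$ (i, j) = conjugate (A $$ (j, i))"
  using assms unfolding mat_adjoint_def by (auto simp: mat_of_rows_index)

lemma op_adjoint_Re:
  assumes "real_linear_op n R" "x \<in> carrier_vec n" "y \<in> carrier_vec n"
  shows "Re (R x \<bullet>c y) = Re (x \<bullet>c op_adjoint n R y)"
proof -
  obtain C B where rep: "represents n R C B" using represents_ex[OF assms(1)] by blast
  have c: "C \<in> carrier_mat n n" "B \<in> carrier_mat n n"
    and R: "R x = C *\<^sub>v x + B *\<^sub>v conjugate x"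
    using rep assms unfolding represents_def by auto
  have adj: "op_adjoint n R y = mat_adjoint C *\<^sub>v y + transpose_mat B *\<^sub>v conjugate y"
    unfolding op_adjoint_def parts_eqI[OF rep] ..
  have dm: "dim_row (mat_adjoint C) = n" "dim_col (mat_adjoint C) = n"
    using c unfolding mat_adjoint_def by auto
  let ?c = "\<lambda>r j. C $$ (r, j) * x $ j * cnj (y $ r)"
  let ?b = "\<lambda>r j. B $$ (r, j) * cnj (x $ j) * cnj (y $ r)"
  have "R x \<bullet>c y = (\<Sum>r<n. (R x) $ r * cnj (y $ r))"
    using c assms by (simp add: scalar_prod_def lessThan_atLeast0)
  also have "\<dots> = (\<Sum>r<n. (\<Sum>j<n. ?c r j) + (\<Sum>j<n. ?b r j))"
  proof (rule sum.cong[OF refl])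
    fix r assume "r \<in> {..<n}"
    then have "(R x) $ r = (\<Sum>j<n. C $$ (r, j) * x $ j) + (\<Sum>j<n. B $$ (r, j) * cnj (x $ j))"
      unfolding R using c assms by (simp add: scalar_prod_def lessThan_atLeast0)
    then show "(R x) $ r * cnj (y $ r) = (\<Sum>j<n. ?c r j) + (\<Sum>j<n. ?b r j)"
      by (simp add: distrib_right sum_distrib_right)
  qed
  finally have l: "R x \<bullet>c y = (\<Sum>r<n. \<Sum>j<n. ?c r j) + (\<Sum>r<n. \<Sum>j<n. ?b r j)"
    by (simp add: sum.distrib)
  have "x \<bullet>c op_adjoint n R y = (\<Sum>j<n. x $ j * cnj (op_adjoint n R y $ j))"
    unfolding adj using c assms dm by (simp add: scalar_prod_def lessThan_atLeast0)
  also have "\<dots> = (\<Sum>j<n. (\<Sum>r<n. ?c r j) + (\<Sum>r<n. cnj (?b r j)))"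
  proof (rule sum.cong[OF refl])
    fix j assume "j \<in> {..<n}"
    then have "op_adjoint n R y $ j
        = (\<Sum>r<n. cnj (C $$ (r, j)) * y $ r) + (\<Sum>r<n. B $$ (r, j) * cnj (y $ r))"
      unfolding adj using c assms dm
      by (simp add: scalar_prod_def lessThan_atLeast0 mat_adjoint_index)
    then show "x $ j * cnj (op_adjoint n R y $ j) = (\<Sum>r<n. ?c r j) + (\<Sum>r<n. cnj (?b r j))"
      by (simp add: distrib_left sum_distrib_left mult_ac)
  qed
  also have "\<dots> = (\<Sum>j<n. \<Sum>r<n. ?c r j) + (\<Sum>j<n. \<Sum>r<n. cnj (?b r j))"
    by (simp add: sum.distrib)
  also have "(\<Sum>j<n. \<Sum>r<n. ?c r j) = (\<Sum>r<n. \<Sum>j<n. ?c r j)" by (rule sum.swap)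
  also have "(\<Sum>j<n. \<Sum>r<n. cnj (?b r j)) = (\<Sum>r<n. \<Sum>j<n. cnj (?b r j))" by (rule sum.swap)
  also have "\<dots> = cnj (\<Sum>r<n. \<Sum>j<n. ?b r j)" by (simp only: cnj_sum)
  finally show ?thesis unfolding l by (simp only: plus_complex.sel cnj.sel)
qed

lemma represents_op_shift:
  assumes "represents n R C B"
  shows "represents n (op_shift R \<mu>) (C - \<mu> \<cdot>\<^sub>m 1\<^sub>m n) B"
proof -
  have c: "C \<in> carrier_mat n n" "B \<in> carrier_mat n n" using assms unfolding represents_def by auto
  have "C *\<^sub>v x + B *\<^sub>v conjugate x - \<mu> \<cdot>\<^sub>v x = (C - \<mu> \<cdot>\<^sub>m 1\<^sub>m n) *\<^sub>v x + B *\<^sub>v conjugate x"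
    if x: "x \<in> carrier_vec n" for x
  proof -
    have "(C - \<mu> \<cdot>\<^sub>m 1\<^sub>m n) *\<^sub>v x = C *\<^sub>v x - (\<mu> \<cdot>\<^sub>m 1\<^sub>m n) *\<^sub>v x"
      using c x by (intro minus_mult_distrib_mat_vec) auto
    also have "(\<mu> \<cdot>\<^sub>m 1\<^sub>m n) *\<^sub>v x = \<mu> \<cdot>\<^sub>v x"
    proof (rule eq_vecI)
      fix i assume "i < dim_vec (\<mu> \<cdot>\<^sub>v x)"
      then have i: "i < n" using x by auto
      have "((\<mu> \<cdot>\<^sub>m 1\<^sub>m n) *\<^sub>v x) $ i = (\<mu> \<cdot>\<^sub>v row (1\<^sub>m n) i) \<bullet> x"
        using i x by (simp add: row_smult)
      also have "\<dots> = (\<mu> \<cdot>\<^sub>v x) $ i" using i x by simp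
      finally show "((\<mu> \<cdot>\<^sub>m 1\<^sub>m n) *\<^sub>v x) $ i = (\<mu> \<cdot>\<^sub>v x) $ i" .
    qed (use x in auto)
    finally show ?thesis using c x by auto
  qed
  then show ?thesis using assms unfolding represents_def op_shift_def by auto
qed

lemma op_charpoly_eq:
  assumes "represents n R C B"
  shows "op_charpoly n R \<mu> = det (four_block_mat (C - \<mu> \<cdot>\<^sub>m 1\<^sub>m n) B
           (map_mat cnj B) (map_mat cnj (C - \<mu> \<cdot>\<^sub>m 1\<^sub>m n)))"
  unfolding op_charpoly_def complexification_def parts_eqI[OF represents_op_shift[OF assms]] Let_def ..

lemma coeff_matrix_ex:
  assumes "real_linear_op n R"
  shows "\<exists>H. is_coeff_matrix n (op_charpoly n R) H"
proof -
  obtain C B where rep: "represents n R C B" using represents_ex[OF assms] by blast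
  have c: "C \<in> carrier_mat n n" "B \<in> carrier_mat n n" using rep unfolding represents_def by auto
  define M where "M \<mu> = four_block_mat (C - \<mu> \<cdot>\<^sub>m 1\<^sub>m n) B
    (map_mat cnj B) (map_mat cnj (C - \<mu> \<cdot>\<^sub>m 1\<^sub>m n))" for \<mu>
  define E :: "nat \<Rightarrow> nat \<Rightarrow> complex poly" where "E i j =
    (if i < n then if j < n then [:C $$ (i, j), - (if i = j then 1 else 0):] else [:B $$ (i, j - n):]
     else if j < n then [:cnj (B $$ (i - n, j)):]
     else [:cnj (C $$ (i - n, j - n)), - (if i = j then 1 else 0):])" for i j
  have degE: "degree (E i j) \<le> 1" for i j unfolding E_def by auto
  have M: "M \<mu> $$ (i, j) = poly (E i j) (if i < n then \<mu> else cnj \<mu>)"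
    if "i < n + n" "j < n + n" for \<mu> i j
    using that c unfolding M_def E_def by auto
  have Mc: "M \<mu> \<in> carrier_mat (n + n) (n + n)" for \<mu> using c unfolding M_def by auto
  define P where "P p = (\<Prod>i = 0..<n. E i (p i))" for p
  define Q where "Q p = (\<Prod>i = n..<n + n. E i (p i))" for p
  have deg: "degree (P p) \<le> n" "degree (Q p) \<le> n" for p
  proof -
    have "degree (P p) \<le> (\<Sum>i = 0..<n. degree (E i (p i)))"
      unfolding P_def by (intro degree_prod_sum_le[unfolded o_def]) auto
    also have "\<dots> \<le> n" using sum_bounded_above[of "{0..<n}" "\<lambda>i. degree (E i (p i))" 1] degE by auto
    finally show "degree (P p) \<le> n" .
    have "degree (Q p) \<le> (\<Sum>i = n..<n + n. degree (E i (p i)))"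
      unfolding Q_def by (intro degree_prod_sum_le[unfolded o_def]) auto
    also have "\<dots> \<le> n" using sum_bounded_above[of "{n..<n + n}" "\<lambda>i. degree (E i (p i))" 1] degE by auto
    finally show "degree (Q p) \<le> n" .
  qed
  let ?S = "{p. p permutes {0..<n + n}}"
  have val: "poly p x = (\<Sum>k\<le>n. coeff p k * x ^ k)" if "degree p \<le> n" for p :: "complex poly" and x
    using arg_cong[OF poly_as_sum_of_monoms'[OF that], of "\<lambda>q. poly q x"]
    by (simp add: poly_sum poly_monom)
  define H where "H = mat (n + 1) (n + 1) (\<lambda>(i, j). \<Sum>p\<in>?S. signof p * coeff (Q p) i * coeff (P p) j)"
  have "op_charpoly n R \<mu> = (\<Sum>i\<le>n. \<Sum>j\<le>n. H $$ (i, j) * \<mu> ^ j * cnj \<mu> ^ i)" for \<mu>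
  proof -
    have "op_charpoly n R \<mu> = det (M \<mu>)" unfolding op_charpoly_eq[OF rep] M_def ..
    also have "\<dots> = (\<Sum>p\<in>?S. signof p * (\<Prod>i = 0..<n + n. M \<mu> $$ (i, p i)))"
      using Mc[of \<mu>] unfolding det_def by auto
    also have "\<dots> = (\<Sum>p\<in>?S. signof p * (poly (P p) \<mu> * poly (Q p) (cnj \<mu>)))"
    proof (rule sum.cong[OF refl])
      fix p assume "p \<in> ?S"
      then have lt: "\<And>i. i < n + n \<Longrightarrow> p i < n + n"
        using permutes_in_image[of p "{0..<n + n}"] by auto
      have "(\<Prod>i = 0..<n + n. M \<mu> $$ (i, p i))
          = (\<Prod>i = 0..<n. M \<mu> $$ (i, p i)) * (\<Prod>i = n..<n + n. M \<mu> $$ (i, p i))"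
        by (rule prod.atLeastLessThan_concat[symmetric]) auto
      also have "(\<Prod>i = 0..<n. M \<mu> $$ (i, p i)) = poly (P p) \<mu>"
        unfolding P_def poly_prod by (intro prod.cong) (auto simp: M lt)
      also have "(\<Prod>i = n..<n + n. M \<mu> $$ (i, p i)) = poly (Q p) (cnj \<mu>)"
        unfolding Q_def poly_prod by (intro prod.cong) (auto simp: M lt)
      finally show "signof p * (\<Prod>i = 0..<n + n. M \<mu> $$ (i, p i))
        = signof p * (poly (P p) \<mu> * poly (Q p) (cnj \<mu>))" by simp
    qed
    also have "\<dots> = (\<Sum>p\<in>?S. \<Sum>i\<le>n. \<Sum>j\<le>n.
        signof p * coeff (Q p) i * coeff (P p) j * (\<mu> ^ j * cnj \<mu> ^ i))"
    proof (rule sum.cong[OF refl])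
      fix p
      have "poly (P p) \<mu> * poly (Q p) (cnj \<mu>)
          = (\<Sum>i\<le>n. \<Sum>j\<le>n. (coeff (Q p) i * cnj \<mu> ^ i) * (coeff (P p) j * \<mu> ^ j))"
        unfolding val[OF deg(1)] val[OF deg(2)] by (subst mult.commute) (rule sum_product)
      then show "signof p * (poly (P p) \<mu> * poly (Q p) (cnj \<mu>)) = (\<Sum>i\<le>n. \<Sum>j\<le>n.
        signof p * coeff (Q p) i * coeff (P p) j * (\<mu> ^ j * cnj \<mu> ^ i))"
        by (simp add: sum_distrib_left mult_ac)
    qed
    also have "\<dots> = (\<Sum>i\<le>n. \<Sum>p\<in>?S. \<Sum>j\<le>n.
        signof p * coeff (Q p) i * coeff (P p) j * (\<mu> ^ j * cnj \<mu> ^ i))"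
      by (rule sum.swap)
    also have "\<dots> = (\<Sum>i\<le>n. \<Sum>j\<le>n. \<Sum>p\<in>?S.
        signof p * coeff (Q p) i * coeff (P p) j * (\<mu> ^ j * cnj \<mu> ^ i))"
      by (intro sum.cong[OF refl] sum.swap)
    also have "\<dots> = (\<Sum>i\<le>n. \<Sum>j\<le>n. H $$ (i, j) * \<mu> ^ j * cnj \<mu> ^ i)"
    proof (intro sum.cong[OF refl])
      fix i j assume "i \<in> {..n}" "j \<in> {..n}"
      then have "H $$ (i, j) = (\<Sum>p\<in>?S. signof p * coeff (Q p) i * coeff (P p) j)"
        unfolding H_def by auto
      then show "(\<Sum>p\<in>?S. signof p * coeff (Q p) i * coeff (P p) j * (\<mu> ^ j * cnj \<mu> ^ i))
          = H $$ (i, j) * \<mu> ^ j * cnj \<mu> ^ i"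
        by (simp only: sum_distrib_right mult.assoc)
    qed
    finally show ?thesis .
  qed
  moreover have "H \<in> carrier_mat (n + 1) (n + 1)" unfolding H_def by auto
  ultimately show ?thesis unfolding is_coeff_matrix_def by blast
qed

lemma poly_zero_on_reals:
  fixes P :: "complex poly"
  assumes "\<And>x::real. poly P (complex_of_real x) = 0"
  shows "P = 0"
proof (rule ccontr)
  assume "P \<noteq> 0"
  then have "finite {z. poly P z = 0}" by (rule poly_roots_finite)
  moreover have "range complex_of_real \<subseteq> {z. poly P z = 0}" using assms by auto
  ultimately have "finite (range complex_of_real)" using finite_subset by blast
  then show False using finite_imageD[of complex_of_real UNIV] infinite_UNIV_char_0[where 'a = real]
    by (auto simp: inj_on_def)
qed

lemma bivariate_zero:
  fixes a :: "nat \<Rightarrow> nat \<Rightarrow> complex"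
  assumes zero: "\<And>z. (\<Sum>i\<le>n. \<Sum>j\<le>n. a i j * z ^ j * cnj z ^ i) = 0"
    and ij: "i \<le> n" "j \<le> n"
  shows "a i j = 0"
proof -
  define P where "P y = (\<Sum>i\<le>n. \<Sum>j\<le>n. smult (a i j) ([:\<i> * y, 1:] ^ j * [:- \<i> * y, 1:] ^ i))" for y
  define Q where "Q x = (\<Sum>i\<le>n. \<Sum>j\<le>n. smult (a i j) ([:x, \<i>:] ^ j * [:x, - \<i>:] ^ i))" for x
  have PQ: "poly (P y) x = poly (Q x) y" for x y
    unfolding P_def Q_def by (simp add: poly_sum algebra_simps)
  have "poly (P (complex_of_real y)) (complex_of_real x) = 0" for x y :: real
  proof -
    have "cnj (complex_of_real x + \<i> * complex_of_real y) = complex_of_real x - \<i> * complex_of_real y"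
      by simp
    then show ?thesis
      using zero[of "complex_of_real x + \<i> * complex_of_real y"]
      unfolding P_def by (simp add: poly_sum algebra_simps)
  qed
  then have "P (complex_of_real y) = 0" for y :: real by (rule poly_zero_on_reals)
  then have "poly (Q x) (complex_of_real y) = 0" for x and y :: real using PQ by (metis poly_0)
  then have "Q x = 0" for x by (rule poly_zero_on_reals)
  then have Q0: "poly (Q x) y = 0" for x y by simp
  have G: "(\<Sum>j\<le>n. (\<Sum>i\<le>n. a i j * \<nu> ^ i) * \<mu> ^ j) = 0" for \<mu> \<nu>
  proof -
    have x: "(\<mu> + \<nu>) / 2 + \<i> * ((\<mu> - \<nu>) / (2 * \<i>)) = \<mu>"
      "(\<mu> + \<nu>) / 2 - \<i> * ((\<mu> - \<nu>) / (2 * \<i>)) = \<nu>"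
      by (auto simp: field_simps)
    have "poly (Q x) y = (\<Sum>i\<le>n. \<Sum>j\<le>n. a i j * ((x + \<i> * y) ^ j * (x - \<i> * y) ^ i))" for x y
      unfolding Q_def by (simp add: poly_sum mult.commute)
    then have "0 = (\<Sum>i\<le>n. \<Sum>j\<le>n. a i j * (\<mu> ^ j * \<nu> ^ i))"
      using Q0[of "(\<mu> + \<nu>) / 2" "(\<mu> - \<nu>) / (2 * \<i>)"] x by simp
    also have "\<dots> = (\<Sum>j\<le>n. \<Sum>i\<le>n. a i j * (\<mu> ^ j * \<nu> ^ i))" by (rule sum.swap)
    also have "\<dots> = (\<Sum>j\<le>n. (\<Sum>i\<le>n. a i j * \<nu> ^ i) * \<mu> ^ j)"
      by (simp add: sum_distrib_left mult_ac)
    finally show ?thesis by simp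
  qed
  have "(\<Sum>i\<le>n. a i j * \<nu> ^ i) = 0" for \<nu>
    using G ij(2) polyfun_eq_0[of "\<lambda>j. \<Sum>i\<le>n. a i j * \<nu> ^ i" n] by blast
  then show ?thesis using ij(1) polyfun_eq_0[of "\<lambda>i. a i j" n] by blast
qed

lemma coeff_matrix_unique:
  assumes "is_coeff_matrix n p H" and "is_coeff_matrix n p H'"
  shows "H = H'"
proof -
  have c: "H \<in> carrier_mat (n + 1) (n + 1)" "H' \<in> carrier_mat (n + 1) (n + 1)"
    using assms unfolding is_coeff_matrix_def by auto
  have "(\<Sum>i\<le>n. \<Sum>j\<le>n. (H $$ (i, j) - H' $$ (i, j)) * z ^ j * cnj z ^ i) = 0" for z
  proof -
    have "(\<Sum>i\<le>n. \<Sum>j\<le>n. H $$ (i, j) * z ^ j * cnj z ^ i)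
        = (\<Sum>i\<le>n. \<Sum>j\<le>n. H' $$ (i, j) * z ^ j * cnj z ^ i)"
      using assms unfolding is_coeff_matrix_def by metis
    then show ?thesis by (simp add: left_diff_distrib sum_subtractf)
  qed
  then have "H $$ (i, j) - H' $$ (i, j) = 0" if "i \<le> n" "j \<le> n" for i j
    by (rule bivariate_zero[OF _ that])
  then show ?thesis using c by (intro eq_matI) auto
qed

lemma charpoly_coeffs:
  assumes "real_linear_op n R"
  shows "is_coeff_matrix n (op_charpoly n R) (charpoly_coeffs n R)"
  unfolding charpoly_coeffs_def
  using coeff_matrix_ex[OF assms] coeff_matrix_unique by (blast intro: theI)

end

theory Submission
  imports Defs
begin

text \<open>The matrix $(R-\mu)^{\mathbb C}$ has a hidden symmetry: conjugating all its entries has the same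
effect as exchanging its two block rows and its two block columns, and that exchange leaves the
determinant alone (\<open>det_four_block_swap\<close>). So the determinant is real. The same exchange, applied
after transposition, turns the block matrix of $R-\overline\mu$ into that of $R^*-\mu$. Everything
about the coefficients follows from these two identities of functions, because a coefficient matrix
is determined by its function: conjugating the function replaces $H$ by $H^*$, and conjugating the
argument replaces $H$ by $H^T$.

With $v(\mu)=(1,\mu,\dots,\mu^n)$ the value of $p$ at $\mu$ is the value of the Hermitian form of $H$
at $v(\mu)$. Each factorization $H=L^*DL$ with $D$ diagonal therefore writes $p$ as a weighted sum of
squared moduli of the polynomials whose coefficients are the rows of $L$
(\<open>quadratic_form_eq_sum_squares\<close>). A unitary diagonalization is one such factorization; its
polynomials have no common zero since $Uv=0$ would force $v=0$, while the first entry of $v$ is $1$.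
For a positive definite $H$, completing squares from the last variable downwards gives $D=1$ and a
lower triangular $L$ (\<open>positive_form_triangular_factorization\<close>), hence polynomials of degrees
$0,1,\dots,n$; the one of degree $0$ has no zero, so $p$ is positive everywhere.

The spectrum is the zero set of $p$, since $R-\mu$ is bijective exactly when its block matrix is
nonsingular (\<open>bij_op_iff_det_nonzero\<close>): vectors of the form $(x,\overline x)$ are a real form of
$\mathbb C^{2n}$ that the block matrix preserves. On the real axis $p$ coincides with the usual
characteristic polynomial of $R^{\mathbb C}$, a monic polynomial of even degree with real values, so
it is eventually positive there; as $p(0)=\det R^{\mathbb C}$, the intermediate value theorem gives a
real zero if this determinant is not positive (\<open>op_charpoly_zero_if_det_nonpos\<close>).\<close>

section \<open>Symmetries of the characteristic polynomial\<close>

text \<open>Exchanging both the block rows and the block columns is conjugation by the involution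
$J$ that swaps the two halves of the coordinates, and $(\det J)^2=1$.\<close>

lemma det_four_block_swap:
  fixes A B C D :: "'a :: idom mat"
  assumes c: "A \<in> carrier_mat n n" "B \<in> carrier_mat n n" "C \<in> carrier_mat n n" "D \<in> carrier_mat n n"
  shows "det (four_block_mat A B C D) = det (four_block_mat D C B A)"
proof -
  define J :: "'a mat" where "J = four_block_mat (0\<^sub>m n n) (1\<^sub>m n) (1\<^sub>m n) (0\<^sub>m n n)"
  define M where "M = four_block_mat A B C D"
  have J: "J \<in> carrier_mat (n + n) (n + n)" and M: "M \<in> carrier_mat (n + n) (n + n)"
    unfolding J_def M_def using c by auto
  have "J * J = four_block_mat (1\<^sub>m n) (0\<^sub>m n n) (0\<^sub>m n n) (1\<^sub>m n)"
    unfolding J_def by (subst mult_four_block_mat) auto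
  then have "J * J = 1\<^sub>m (n + n)" by (simp only: four_block_one_mat)
  then have dJ: "det J * det J = 1" using det_mult[OF J J] by simp
  have JM: "J * M = four_block_mat C D A B"
    unfolding J_def M_def using c by (subst mult_four_block_mat) auto
  have "J * M * J = four_block_mat D C B A"
    unfolding JM unfolding J_def using c by (subst mult_four_block_mat) auto
  moreover have "det (J * M * J) = det J * det M * det J"
    using det_mult[OF mult_carrier_mat[OF J M] J] det_mult[OF J M] by simp
  ultimately show ?thesis using dJ unfolding M_def by (simp add: mult_ac)
qed

text \<open>Entrywise conjugation of such a block matrix amounts to the exchange of block rows and columns,
so the determinant equals its own conjugate.\<close>

lemma det_conj_block_real:
  assumes c: "C \<in> carrier_mat n n" "B \<in> carrier_mat n n"
  shows "det (four_block_mat C B (map_mat cnj B) (map_mat cnj C)) \<in> \<real>"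
proof -
  interpret cnj: comm_ring_hom cnj by unfold_locales auto
  let ?M = "four_block_mat C B (map_mat cnj B) (map_mat cnj C)"
  have "cnj (det ?M) = det (map_mat cnj ?M)" by simp
  also have "map_mat cnj ?M = four_block_mat (map_mat cnj C) (map_mat cnj B) B C"
    using c by (intro eq_matI) auto
  also have "det \<dots> = det ?M" using c by (intro det_four_block_swap) auto
  finally show ?thesis by (simp add: Reals_cnj_iff)
qed

lemma op_charpoly_real:
  assumes "represents n R C B"
  shows "op_charpoly n R \<mu> \<in> \<real>"
  unfolding op_charpoly_eq[OF assms] using assms
  by (intro det_conj_block_real) (auto simp: represents_def)

lemma represents_adjoint:
  assumes "represents n R C B"
  shows "represents n (op_adjoint n R) (mat_adjoint C) (transpose_mat B)"
  using assms unfolding represents_def op_adjoint_def parts_eqI[OF assms]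
  by (auto simp: mat_adjoint_def)

text \<open>The transpose of the block matrix of $R-\overline\mu$ consists of the blocks of $R^*-\mu$ with
the two diagonal ones exchanged, and likewise the two off-diagonal ones.\<close>

lemma op_charpoly_adjoint:
  assumes rep: "represents n R C B"
  shows "op_charpoly n (op_adjoint n R) \<mu> = op_charpoly n R (cnj \<mu>)"
proof -
  have c: "C \<in> carrier_mat n n" "B \<in> carrier_mat n n" using rep unfolding represents_def by auto
  have m: "mat_adjoint C \<in> carrier_mat n n" using c by (auto simp: mat_adjoint_def)
  let ?A = "C - cnj \<mu> \<cdot>\<^sub>m 1\<^sub>m n"
  let ?M = "four_block_mat ?A B (map_mat cnj B) (map_mat cnj ?A)"
  have A: "?A \<in> carrier_mat n n" using c by auto
  have e1: "transpose_mat (map_mat cnj ?A) = mat_adjoint C - \<mu> \<cdot>\<^sub>m 1\<^sub>m n"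
    using c m by (intro eq_matI) (auto simp: mat_adjoint_index)
  then have e2: "transpose_mat ?A = map_mat cnj (mat_adjoint C - \<mu> \<cdot>\<^sub>m 1\<^sub>m n)"
    using c m by (intro eq_matI) (auto simp: mat_adjoint_index)
  have e3: "transpose_mat (map_mat cnj B) = map_mat cnj (transpose_mat B)"
    by (intro eq_matI) auto
  have "op_charpoly n R (cnj \<mu>) = det (transpose_mat ?M)"
    unfolding op_charpoly_eq[OF rep] using c by (intro det_transpose[symmetric]) auto
  also have "transpose_mat ?M = four_block_mat (transpose_mat ?A) (transpose_mat (map_mat cnj B))
      (transpose_mat B) (transpose_mat (map_mat cnj ?A))"
    using c A by (intro transpose_four_block_mat) auto
  also have "det \<dots> = det (four_block_mat (transpose_mat (map_mat cnj ?A)) (transpose_mat B)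
      (transpose_mat (map_mat cnj B)) (transpose_mat ?A))"
    using c A by (intro det_four_block_swap) auto
  also have "\<dots> = op_charpoly n (op_adjoint n R) \<mu>"
    unfolding op_charpoly_eq[OF represents_adjoint[OF rep]] e1 e2 e3 ..
  finally show ?thesis by simp
qed

lemma is_coeff_matrix_transpose:
  assumes "is_coeff_matrix n p H"
  shows "is_coeff_matrix n (\<lambda>\<mu>. p (cnj \<mu>)) (transpose_mat H)"
  unfolding is_coeff_matrix_def
proof (intro conjI allI)
  have H: "H \<in> carrier_mat (n + 1) (n + 1)"
    and p: "\<And>\<mu>. p \<mu> = (\<Sum>i\<le>n. \<Sum>j\<le>n. H $$ (i, j) * \<mu> ^ j * cnj \<mu> ^ i)"
    using assms unfolding is_coeff_matrix_def by auto
  show "transpose_mat H \<in> carrier_mat (n + 1) (n + 1)" using H by auto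
  fix \<mu>
  have "p (cnj \<mu>) = (\<Sum>j\<le>n. \<Sum>i\<le>n. H $$ (i, j) * cnj \<mu> ^ j * \<mu> ^ i)"
    unfolding p by (subst sum.swap) simp
  also have "\<dots> = (\<Sum>i\<le>n. \<Sum>j\<le>n. transpose_mat H $$ (i, j) * \<mu> ^ j * cnj \<mu> ^ i)"
    using H by (intro sum.cong) auto
  finally show "p (cnj \<mu>) = \<dots>" .
qed

lemma is_coeff_matrix_cnj:
  assumes "is_coeff_matrix n p H"
  shows "is_coeff_matrix n (\<lambda>\<mu>. cnj (p \<mu>)) (mat_adjoint H)"
  unfolding is_coeff_matrix_def
proof (intro conjI allI)
  have H: "H \<in> carrier_mat (n + 1) (n + 1)"
    and p: "\<And>\<mu>. p \<mu> = (\<Sum>i\<le>n. \<Sum>j\<le>n. H $$ (i, j) * \<mu> ^ j * cnj \<mu> ^ i)"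
    using assms unfolding is_coeff_matrix_def by auto
  show "mat_adjoint H \<in> carrier_mat (n + 1) (n + 1)" using H by (auto simp: mat_adjoint_def)
  fix \<mu>
  have "cnj (p \<mu>) = (\<Sum>j\<le>n. \<Sum>i\<le>n. cnj (H $$ (i, j)) * cnj \<mu> ^ j * \<mu> ^ i)"
    unfolding p by (subst sum.swap) simp
  also have "\<dots> = (\<Sum>i\<le>n. \<Sum>j\<le>n. mat_adjoint H $$ (i, j) * \<mu> ^ j * cnj \<mu> ^ i)"
    using H by (intro sum.cong) (auto simp: mat_adjoint_index)
  finally show "cnj (p \<mu>) = \<dots>" .
qed

text \<open>For a real valued $p$ both $H$ and $H^*$ are coefficient matrices of $p$, and there is only
one.\<close>

lemma hermitian_coeff_matrix:
  assumes H: "is_coeff_matrix n p H" and "\<And>\<mu>. p \<mu> \<in> \<real>"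
  shows "hermitian_mat H"
proof -
  have "(\<lambda>\<mu>. cnj (p \<mu>)) = p" using assms(2) by (intro ext) (simp add: Reals_cnj_iff)
  then have "is_coeff_matrix n p (mat_adjoint H)" using is_coeff_matrix_cnj[OF H] by metis
  then have "mat_adjoint H = H" by (rule coeff_matrix_unique[OF _ H])
  moreover have "square_mat H" using H unfolding is_coeff_matrix_def by auto
  ultimately show ?thesis unfolding hermitian_mat_def by simp
qed

lemma hermitian_index:
  assumes "hermitian_mat H" "H \<in> carrier_mat m m" "i < m" "j < m"
  shows "H $$ (i, j) = cnj (H $$ (j, i))"
  using assms mat_adjoint_index[of i H j] unfolding hermitian_mat_def by auto

section \<open>The spectrum is the zero set of the characteristic polynomial\<close>

lemma mult_conjugate_mat_vec:
  assumes "A \<in> carrier_mat n n" "x \<in> carrier_vec n"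
  shows "map_mat cnj A *\<^sub>v conjugate x = conjugate (A *\<^sub>v x)"
  using assms by (intro eq_vecI) (auto simp: scalar_prod_def)

lemma surj_if_det_nonzero:
  fixes A :: "complex mat"
  assumes A: "A \<in> carrier_mat n n" and d: "det A \<noteq> 0" and y: "y \<in> carrier_vec n"
  obtains x where "x \<in> carrier_vec n" "A *\<^sub>v x = y"
proof -
  let ?x = "(1 / det A) \<cdot>\<^sub>v (adj_mat A *\<^sub>v y)"
  have J: "adj_mat A \<in> carrier_mat n n" "A * adj_mat A = det A \<cdot>\<^sub>m 1\<^sub>m n"
    using adj_mat[OF A] by auto
  have "A *\<^sub>v ?x = (1 / det A) \<cdot>\<^sub>v ((A * adj_mat A) *\<^sub>v y)"
    unfolding assoc_mult_mat_vec[OF A J(1) y] using A J(1) y by (intro mult_mat_vec) auto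
  also have "\<dots> = y" unfolding J(2) using d y
    by (intro eq_vecI) (auto simp: row_smult)
  finally show thesis using that[of ?x] J y by auto
qed

text \<open>With the second half of the vector written as $\overline w$, exchanging $u$ and $w$ exchanges
the halves of the product up to conjugation. For $u=w=x$ the product is $(y,\overline y)$ with
$y=Cx+B\overline x$.\<close>

lemma conj_block_mult_vec:
  assumes C: "C \<in> carrier_mat n n" and B: "B \<in> carrier_mat n n"
    and u: "u \<in> carrier_vec n" and w: "w \<in> carrier_vec n"
  shows "four_block_mat C B (map_mat cnj B) (map_mat cnj C) *\<^sub>v (u @\<^sub>v conjugate w) =
    (C *\<^sub>v u + B *\<^sub>v conjugate w) @\<^sub>v conjugate (C *\<^sub>v w + B *\<^sub>v conjugate u)"
proof -
  have w': "conjugate w \<in> carrier_vec n" using w by simp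
  have "map_mat cnj B *\<^sub>v u = conjugate (B *\<^sub>v conjugate u)"
    using mult_conjugate_mat_vec[OF B, of "conjugate u"] u by simp
  moreover have "map_mat cnj C *\<^sub>v conjugate w = conjugate (C *\<^sub>v w)"
    by (rule mult_conjugate_mat_vec[OF C w])
  moreover have "conjugate (B *\<^sub>v conjugate u) + conjugate (C *\<^sub>v w)
      = conjugate (C *\<^sub>v w + B *\<^sub>v conjugate u)"
    using B C u w
    by (subst conjugate_add_vec[of _ n]) (auto intro: comm_add_vec[of _ n])
  moreover have "map_mat cnj B \<in> carrier_mat n n" "map_mat cnj C \<in> carrier_mat n n"
    using B C by auto
  ultimately show ?thesis using four_block_mat_mult_vec[OF C B _ _ u w'] by metis
qed

lemma split_conj_vec:
  fixes v :: "complex vec"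
  assumes "v \<in> carrier_vec (n + n)"
  obtains u w where "u \<in> carrier_vec n" "w \<in> carrier_vec n" "v = u @\<^sub>v conjugate w"
proof (rule that)
  show "v = vec_first v n @\<^sub>v conjugate (conjugate (vec_last v n))" using assms by simp
qed auto

lemma real_linear_comb:
  assumes rep: "represents n S C B" and u: "u \<in> carrier_vec n" and w: "w \<in> carrier_vec n"
    and k: "k < n"
  shows "S (a \<cdot>\<^sub>v u + b \<cdot>\<^sub>v w) $ k = a * (C *\<^sub>v u) $ k + cnj a * (B *\<^sub>v conjugate u) $ k
    + (b * (C *\<^sub>v w) $ k + cnj b * (B *\<^sub>v conjugate w) $ k)"
proof -
  have C: "C \<in> carrier_mat n n" and B: "B \<in> carrier_mat n n"
    and S: "S (a \<cdot>\<^sub>v u + b \<cdot>\<^sub>v w) = C *\<^sub>v (a \<cdot>\<^sub>v u + b \<cdot>\<^sub>v w) + B *\<^sub>v conjugate (a \<cdot>\<^sub>v u + b \<cdot>\<^sub>v w)"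
    using rep u w unfolding represents_def by auto
  have lin: "(A *\<^sub>v (c \<cdot>\<^sub>v x + d \<cdot>\<^sub>v y)) $ k = c * (A *\<^sub>v x) $ k + d * (A *\<^sub>v y) $ k"
    if "A \<in> carrier_mat n n" "x \<in> carrier_vec n" "y \<in> carrier_vec n"
    for A :: "complex mat" and c d x y
    using that k by (simp add: scalar_prod_def sum_distrib_left sum.distrib algebra_simps)
  have "conjugate (a \<cdot>\<^sub>v u + b \<cdot>\<^sub>v w) = cnj a \<cdot>\<^sub>v conjugate u + cnj b \<cdot>\<^sub>v conjugate w"
    using u w by (intro eq_vecI) auto
  then have "S (a \<cdot>\<^sub>v u + b \<cdot>\<^sub>v w) $ k = (C *\<^sub>v (a \<cdot>\<^sub>v u + b \<cdot>\<^sub>v w)) $ k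
      + (B *\<^sub>v (cnj a \<cdot>\<^sub>v conjugate u + cnj b \<cdot>\<^sub>v conjugate w)) $ k"
    unfolding S using k B by (simp del: index_mult_mat_vec)
  then show ?thesis
    using lin[OF C u w, of a b] lin[OF B, of "conjugate u" "conjugate w" "cnj a" "cnj b"] u w
    by simp
qed

text \<open>A null vector $(u,\overline w)$ of the block matrix gives a null vector $(w,\overline u)$ as
well. Their combination with coefficients $a$ and $\overline a$ has the form $(x,\overline x)$, and
then $x=au+\overline aw$ lies in the kernel of $S$. The two vectors $u+w$ and $iu-iw$ of this kind
cannot both vanish.\<close>

lemma op_kernel_if_det_zero:
  assumes rep: "represents n S C B"
    and d: "det (four_block_mat C B (map_mat cnj B) (map_mat cnj C)) = 0"
  obtains x where "x \<in> carrier_vec n" "x \<noteq> 0\<^sub>v n" "S x = 0\<^sub>v n"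
proof -
  let ?M = "four_block_mat C B (map_mat cnj B) (map_mat cnj C)"
  have C: "C \<in> carrier_mat n n" and B: "B \<in> carrier_mat n n"
    and S: "\<And>x. x \<in> carrier_vec n \<Longrightarrow> S x = C *\<^sub>v x + B *\<^sub>v conjugate x"
    using rep unfolding represents_def by auto
  have M: "?M \<in> carrier_mat (n + n) (n + n)" using C B by auto
  have zero: "(0\<^sub>v n @\<^sub>v 0\<^sub>v n :: complex vec) = 0\<^sub>v (n + n)" by (intro eq_vecI) auto
  obtain v where v: "v \<in> carrier_vec (n + n)" "v \<noteq> 0\<^sub>v (n + n)" "?M *\<^sub>v v = 0\<^sub>v (n + n)"
    using d det_0_iff_vec_prod_zero[OF M] by blast
  obtain u w where u: "u \<in> carrier_vec n" and w: "w \<in> carrier_vec n" and vuw: "v = u @\<^sub>v conjugate w"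
    using split_conj_vec[OF v(1)] by blast
  have "(C *\<^sub>v u + B *\<^sub>v conjugate w) @\<^sub>v conjugate (C *\<^sub>v w + B *\<^sub>v conjugate u) = 0\<^sub>v n @\<^sub>v 0\<^sub>v n"
    using v(3) conj_block_mult_vec[OF C B u w] unfolding vuw zero by metis
  moreover have "C *\<^sub>v u + B *\<^sub>v conjugate w \<in> carrier_vec n" using B C u w by auto
  ultimately have "C *\<^sub>v u + B *\<^sub>v conjugate w = 0\<^sub>v n"
      "conjugate (C *\<^sub>v w + B *\<^sub>v conjugate u) = 0\<^sub>v n"
    by (metis append_vec_eq zero_carrier_vec)+
  then have E: "C *\<^sub>v u + B *\<^sub>v conjugate w = 0\<^sub>v n" "C *\<^sub>v w + B *\<^sub>v conjugate u = 0\<^sub>v n" by simp_all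
  have i1: "(C *\<^sub>v u) $ k + (B *\<^sub>v conjugate w) $ k = 0" if "k < n" for k
    using arg_cong[OF E(1), of "\<lambda>x. x $ k"] that B by (simp del: index_mult_mat_vec)
  have i2: "(C *\<^sub>v w) $ k + (B *\<^sub>v conjugate u) $ k = 0" if "k < n" for k
    using arg_cong[OF E(2), of "\<lambda>x. x $ k"] that B by (simp del: index_mult_mat_vec)
  \<comment> \<open>The kernel vectors that are needed are the cases \<open>a = 1\<close> and \<open>a = \<i>\<close>.\<close>
  have ker: "S (a \<cdot>\<^sub>v u + cnj a \<cdot>\<^sub>v w) = 0\<^sub>v n" for a
  proof (rule eq_vecI)
    show "dim_vec (S (a \<cdot>\<^sub>v u + cnj a \<cdot>\<^sub>v w)) = dim_vec (0\<^sub>v n)"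
      using S[of "a \<cdot>\<^sub>v u + cnj a \<cdot>\<^sub>v w"] u w B by simp
    fix k assume "k < dim_vec (0\<^sub>v n :: complex vec)"
    then have k: "k < n" by simp
    have "S (a \<cdot>\<^sub>v u + cnj a \<cdot>\<^sub>v w) $ k = a * ((C *\<^sub>v u) $ k + (B *\<^sub>v conjugate w) $ k)
        + cnj a * ((C *\<^sub>v w) $ k + (B *\<^sub>v conjugate u) $ k)"
      unfolding real_linear_comb[OF rep u w k] by (simp only: complex_cnj_cnj algebra_simps)
    then show "S (a \<cdot>\<^sub>v u + cnj a \<cdot>\<^sub>v w) $ k = 0\<^sub>v n $ k"
      unfolding i1[OF k] i2[OF k] using k by simp
  qed
  show thesis
  proof (cases "u + w = 0\<^sub>v n")
    case False
    then show thesis using that[of "u + w"] ker[of 1] u w by simp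
  next
    case True
    have uw: "w $ k = - u $ k" if "k < n" for k
      using arg_cong[OF True, of "\<lambda>x. x $ k"] that u w by (simp add: eq_neg_iff_add_eq_0 add.commute)
    have "\<i> \<cdot>\<^sub>v u + cnj \<i> \<cdot>\<^sub>v w \<noteq> 0\<^sub>v n"
    proof
      assume z: "\<i> \<cdot>\<^sub>v u + cnj \<i> \<cdot>\<^sub>v w = 0\<^sub>v n"
      have u0: "u $ k = 0" if "k < n" for k
        using arg_cong[OF z, of "\<lambda>x. x $ k"] that u w uw[OF that] by simp
      have "u = 0\<^sub>v n" using u0 u by (intro eq_vecI) auto
      moreover have "w = 0\<^sub>v n" using u0 uw w by (intro eq_vecI) auto
      ultimately show False using v(2) zero vuw by simp
    qed
    then show thesis using that[OF _ _ ker[of \<i>]] u w by simp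
  qed
qed

text \<open>To solve $Su=y$, solve the block system for $(y,\overline y)$. The exchange of the two halves
of a solution, combined with conjugation, is again a solution, so by uniqueness the solution has
the form $(u,\overline u)$.\<close>

lemma bij_op_if_det_nonzero:
  assumes rep: "represents n S C B"
    and d: "det (four_block_mat C B (map_mat cnj B) (map_mat cnj C)) \<noteq> 0"
  shows "bij_betw S (carrier_vec n) (carrier_vec n)"
proof -
  let ?M = "four_block_mat C B (map_mat cnj B) (map_mat cnj C)"
  have C: "C \<in> carrier_mat n n" and B: "B \<in> carrier_mat n n"
    and S: "\<And>x. x \<in> carrier_vec n \<Longrightarrow> S x = C *\<^sub>v x + B *\<^sub>v conjugate x"
    using rep unfolding represents_def by auto
  note Mv = conj_block_mult_vec[OF C B]
  have M: "?M \<in> carrier_mat (n + n) (n + n)" using C B by auto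
  have Sc: "S x \<in> carrier_vec n" if "x \<in> carrier_vec n" for x using S[OF that] C B that by auto
  have MS: "?M *\<^sub>v (x @\<^sub>v conjugate x) = S x @\<^sub>v conjugate (S x)" if "x \<in> carrier_vec n" for x
    using Mv[OF that that] S[OF that] by simp
  have Minj: "v = v'"
    if v: "v \<in> carrier_vec (n + n)" and v': "v' \<in> carrier_vec (n + n)" and eq: "?M *\<^sub>v v = ?M *\<^sub>v v'"
    for v v'
  proof -
    have "?M *\<^sub>v (v - v') = ?M *\<^sub>v v - ?M *\<^sub>v v'" by (rule mult_minus_distrib_mat_vec[OF M v v'])
    also have "\<dots> = 0\<^sub>v (n + n)" unfolding eq by (intro minus_cancel_vec mult_mat_vec_carrier[OF M v'])
    finally have "v - v' = 0\<^sub>v (n + n)"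
      using d det_0_iff_vec_prod_zero[OF M] minus_carrier_vec[OF v v'] by blast
    then have z: "(v - v') $ k = 0" if "k < n + n" for k using that by simp
    have "v $ k = v' $ k" if "k < n + n" for k using z[OF that] that v v' by simp
    then show ?thesis using v v' by (intro eq_vecI) auto
  qed
  have cc: "x @\<^sub>v conjugate y \<in> carrier_vec (n + n)" if "x \<in> carrier_vec n" "y \<in> carrier_vec n"
    for x y :: "complex vec"
    using that by auto
  show ?thesis
    unfolding bij_betw_def
  proof
    show "inj_on S (carrier_vec n)"
    proof (rule inj_onI)
      fix x y assume x: "x \<in> carrier_vec n" and y: "y \<in> carrier_vec n" and eq: "S x = S y"
      have "x @\<^sub>v conjugate x = y @\<^sub>v conjugate y"
        by (rule Minj[OF cc[OF x x] cc[OF y y]]) (simp only: MS[OF x] MS[OF y] eq)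
      then show "x = y" using append_vec_eq[OF x y] by blast
    qed
    have "y \<in> S ` carrier_vec n" if y: "y \<in> carrier_vec n" for y
    proof -
      obtain v where v: "v \<in> carrier_vec (n + n)" and Mv_y: "?M *\<^sub>v v = y @\<^sub>v conjugate y"
        using surj_if_det_nonzero[OF M d cc[OF y y]] by blast
      obtain u w where u: "u \<in> carrier_vec n" and w: "w \<in> carrier_vec n" and vuw: "v = u @\<^sub>v conjugate w"
        using split_conj_vec[OF v] by blast
      have eq: "(C *\<^sub>v u + B *\<^sub>v conjugate w) @\<^sub>v conjugate (C *\<^sub>v w + B *\<^sub>v conjugate u) = y @\<^sub>v conjugate y"
        using Mv_y Mv[OF u w] vuw by metis
      have "C *\<^sub>v u + B *\<^sub>v conjugate w \<in> carrier_vec n" using B C u w by auto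
      from append_vec_eq[OF this y] eq
      have E: "C *\<^sub>v u + B *\<^sub>v conjugate w = y" "C *\<^sub>v w + B *\<^sub>v conjugate u = y"
        by (metis conjugate_cancel_iff)+
      \<comment> \<open>The exchanged vector solves the same system.\<close>
      have "?M *\<^sub>v (w @\<^sub>v conjugate u) = ?M *\<^sub>v v" unfolding Mv[OF w u] E Mv_y ..
      then have "w @\<^sub>v conjugate u = u @\<^sub>v conjugate w"
        using Minj[OF cc[OF w u] v] vuw by metis
      then have "w = u" using append_vec_eq[OF w u] by blast
      then have "S u = y" using S[OF u] E by simp
      then show ?thesis using u by auto
    qed
    then show "S ` carrier_vec n = carrier_vec n" using Sc by auto
  qed
qed

lemma bij_op_iff_det_nonzero:
  assumes rep: "represents n S C B"
  shows "bij_betw S (carrier_vec n) (carrier_vec n) \<longleftrightarrow>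
    det (four_block_mat C B (map_mat cnj B) (map_mat cnj C)) \<noteq> 0"
proof
  assume bij: "bij_betw S (carrier_vec n) (carrier_vec n)"
  have "C \<in> carrier_mat n n" "B \<in> carrier_mat n n" "S (0\<^sub>v n) = C *\<^sub>v 0\<^sub>v n + B *\<^sub>v conjugate (0\<^sub>v n)"
    using rep unfolding represents_def by auto
  then have S0: "S (0\<^sub>v n) = 0\<^sub>v n" by auto
  show "det (four_block_mat C B (map_mat cnj B) (map_mat cnj C)) \<noteq> 0"
  proof
    assume "det (four_block_mat C B (map_mat cnj B) (map_mat cnj C)) = 0"
    then obtain x where "x \<in> carrier_vec n" "x \<noteq> 0\<^sub>v n" "S x = 0\<^sub>v n"
      using op_kernel_if_det_zero[OF rep] by blast
    then show False using bij S0 inj_onD[of S "carrier_vec n" x "0\<^sub>v n"]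
      unfolding bij_betw_def by simp
  qed
qed (rule bij_op_if_det_nonzero[OF rep])

lemma op_spectrum_iff:
  assumes "represents n R C B"
  shows "\<mu> \<in> op_spectrum n R \<longleftrightarrow> op_charpoly n R \<mu> = 0"
  unfolding op_spectrum_def op_charpoly_eq[OF assms]
  using bij_op_iff_det_nonzero[OF represents_op_shift[OF assms]] by simp

section \<open>Sums of squares from factorizations of the coefficient matrix\<close>

text \<open>This is $v^*L^*DLv=(Lv)^*D(Lv)$ in coordinates, for the vector $v=(1,\mu,\dots,\mu^n)$. The weights
\<open>d\<close> are complex, so that the diagonal of $UHU^*$ can be inserted as it stands.\<close>

lemma quadratic_form_eq_sum_squares:
  fixes h L :: "nat \<Rightarrow> nat \<Rightarrow> complex" and d :: "nat \<Rightarrow> complex"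
  assumes "\<And>i j. i \<le> n \<Longrightarrow> j \<le> n \<Longrightarrow> h i j = (\<Sum>k\<le>n. d k * (cnj (L k i) * L k j))"
  shows "(\<Sum>i\<le>n. \<Sum>j\<le>n. h i j * \<mu> ^ j * cnj \<mu> ^ i)
    = (\<Sum>k\<le>n. d k * complex_of_real ((cmod (\<Sum>j\<le>n. L k j * \<mu> ^ j))\<^sup>2))"
proof -
  let ?t = "\<lambda>k i j. d k * ((L k j * \<mu> ^ j) * cnj (L k i * \<mu> ^ i))"
  have "(\<Sum>i\<le>n. \<Sum>j\<le>n. h i j * \<mu> ^ j * cnj \<mu> ^ i) = (\<Sum>i\<le>n. \<Sum>j\<le>n. \<Sum>k\<le>n. ?t k i j)"
    using assms by (intro sum.cong refl) (simp add: sum_distrib_left sum_distrib_right mult_ac)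
  also have "\<dots> = (\<Sum>i\<le>n. \<Sum>k\<le>n. \<Sum>j\<le>n. ?t k i j)"
    by (intro sum.cong refl sum.swap)
  also have "\<dots> = (\<Sum>k\<le>n. \<Sum>i\<le>n. \<Sum>j\<le>n. ?t k i j)" by (rule sum.swap)
  also have "\<dots> = (\<Sum>k\<le>n. d k * complex_of_real ((cmod (\<Sum>j\<le>n. L k j * \<mu> ^ j))\<^sup>2))"
  proof (intro sum.cong refl)
    fix k
    let ?s = "\<Sum>j\<le>n. L k j * \<mu> ^ j"
    have "d k * complex_of_real ((cmod ?s)\<^sup>2) = d k * (cnj ?s * ?s)"
      by (simp only: complex_norm_square mult.commute)
    also have "cnj ?s * ?s = (\<Sum>i\<le>n. \<Sum>j\<le>n. cnj (L k i * \<mu> ^ i) * (L k j * \<mu> ^ j))"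
      unfolding cnj_sum by (rule sum_product)
    finally show "(\<Sum>i\<le>n. \<Sum>j\<le>n. ?t k i j) = d k * complex_of_real ((cmod ?s)\<^sup>2)"
      by (simp add: sum_distrib_left mult_ac)
  qed
  finally show ?thesis .
qed

lemma poly_row_poly:
  "poly (row_poly U i) x = (\<Sum>j<dim_col U. U $$ (i, j) * x ^ j)"
  unfolding row_poly_def by (simp add: poly_sum poly_monom)

lemma mult_index_sum:
  assumes "A \<in> carrier_mat m m" "B \<in> carrier_mat m m" "i < m" "j < m"
  shows "(A * B) $$ (i, j) = (\<Sum>k<m. A $$ (i, k) * B $$ (k, j))"
  using assms by (simp add: scalar_prod_def lessThan_atLeast0)

lemma unitary_diagonalization_index:
  assumes U: "U \<in> carrier_mat m m" "unitary_mat U" and H: "H \<in> carrier_mat m m"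
    and D: "diagonal_mat (U * H * mat_adjoint U)" and ij: "i < m" "j < m"
  shows "H $$ (i, j) = (\<Sum>k<m. (U * H * mat_adjoint U) $$ (k, k) * (cnj (U $$ (k, i)) * U $$ (k, j)))"
proof -
  let ?V = "mat_adjoint U"
  let ?D = "U * H * ?V"
  have V: "?V \<in> carrier_mat m m" using U by (auto simp: mat_adjoint_def)
  have UV: "?V * U = 1\<^sub>m m" using U V unfolding unitary_mat_def inverts_mat_def by auto
  have Dc: "?D \<in> carrier_mat m m" using U H V by auto
  have "?V * (?D * U) = ?V * (U * H * (?V * U))"
    using U H V by (simp add: assoc_mult_mat[of _ m m _ m _ m])
  also have "\<dots> = ?V * (U * H)" unfolding UV using U H by simp
  also have "\<dots> = (?V * U) * H" by (rule assoc_mult_mat[symmetric, OF V U(1) H])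
  also have "\<dots> = H" unfolding UV using H by simp
  finally have "H $$ (i, j) = (?V * (?D * U)) $$ (i, j)" by simp
  also have "\<dots> = (\<Sum>k<m. ?V $$ (i, k) * (?D * U) $$ (k, j))"
    by (rule mult_index_sum[OF V _ ij]) (rule mult_carrier_mat[OF Dc U(1)])
  also have "\<dots> = (\<Sum>k<m. ?D $$ (k, k) * (cnj (U $$ (k, i)) * U $$ (k, j)))"
  proof (intro sum.cong refl)
    fix k assume "k \<in> {..<m}"
    then have k: "k < m" by simp
    have "(?D * U) $$ (k, j) = (\<Sum>l<m. ?D $$ (k, l) * U $$ (l, j))"
      by (rule mult_index_sum[OF Dc U(1) k ij(2)])
    also have "\<dots> = (\<Sum>l<m. if l = k then ?D $$ (k, k) * U $$ (k, j) else 0)"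
    proof (intro sum.cong refl)
      fix l assume "l \<in> {..<m}"
      then have "l \<noteq> k \<Longrightarrow> ?D $$ (k, l) = 0"
        using D k carrier_matD[OF Dc] unfolding diagonal_mat_def by (metis lessThan_iff)
      then show "?D $$ (k, l) * U $$ (l, j) = (if l = k then ?D $$ (k, k) * U $$ (k, j) else 0)"
        by (cases "l = k") (simp_all del: index_mult_mat)
    qed
    also have "\<dots> = ?D $$ (k, k) * U $$ (k, j)" using k by simp
    finally show "?V $$ (i, k) * (?D * U) $$ (k, j) = ?D $$ (k, k) * (cnj (U $$ (k, i)) * U $$ (k, j))"
      using mat_adjoint_index[of i U k] U k ij by simp
  qed
  finally show ?thesis .
qed

text \<open>A common zero $\mu$ would put $(1,\mu,\dots,\mu^n)$ into the kernel of the invertible matrix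
\<open>U\<close>.\<close>

lemma unitary_row_polys_no_common_zero:
  assumes U: "U \<in> carrier_mat (n + 1) (n + 1)" "unitary_mat U"
  shows "\<not> (\<exists>\<mu>. \<forall>i\<le>n. poly (row_poly U i) \<mu> = 0)"
proof
  assume "\<exists>\<mu>. \<forall>i\<le>n. poly (row_poly U i) \<mu> = 0"
  then obtain \<mu> where z: "\<And>i. i \<le> n \<Longrightarrow> poly (row_poly U i) \<mu> = 0" by blast
  let ?v = "vec (n + 1) (\<lambda>j. \<mu> ^ j)"
  have V: "mat_adjoint U \<in> carrier_mat (n + 1) (n + 1)" using U by (auto simp: mat_adjoint_def)
  have "U *\<^sub>v ?v = 0\<^sub>v (n + 1)"
    using U z by (intro eq_vecI) (auto simp: scalar_prod_def poly_row_poly lessThan_atLeast0)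
  moreover have "mat_adjoint U *\<^sub>v (U *\<^sub>v ?v) = (mat_adjoint U * U) *\<^sub>v ?v"
    by (rule assoc_mult_mat_vec[symmetric, OF V U(1)]) simp
  moreover have "mat_adjoint U * U = 1\<^sub>m (n + 1)"
    using U V unfolding unitary_mat_def inverts_mat_def by auto
  ultimately have "?v = mat_adjoint U *\<^sub>v 0\<^sub>v (n + 1)" by simp
  also have "\<dots> = 0\<^sub>v (n + 1)" using V by auto
  finally have "?v $ 0 = 0\<^sub>v (n + 1) $ 0" by (rule arg_cong)
  then show False by simp
qed

text \<open>This is the Cholesky factorization $h=L^*L$ with a lower triangular $L$, instead of the usual
upper triangular one, so it removes the last variable first: the form minus the squared modulus of
\<open>\<Sum>j. l j * x j\<close>, where \<open>l\<close> is the last row of \<open>h\<close> divided by the root of its diagonal entry, no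
longer involves that variable. The form \<open>g\<close> that remains is positive, because for given values
of the other variables the last one can be chosen to make the subtracted square zero.\<close>

lemma positive_form_triangular_factorization:
  fixes h :: "nat \<Rightarrow> nat \<Rightarrow> complex"
  assumes "\<And>i j. i < m \<Longrightarrow> j < m \<Longrightarrow> h i j = cnj (h j i)"
    and "\<And>x. \<exists>i<m. x i \<noteq> 0 \<Longrightarrow> 0 < (\<Sum>i<m. \<Sum>j<m. h i j * x j * cnj (x i))"
  shows "\<exists>L. (\<forall>k<m. L k k \<noteq> 0) \<and> (\<forall>k<m. \<forall>j>k. L k j = 0) \<and>
    (\<forall>i<m. \<forall>j<m. h i j = (\<Sum>k<m. cnj (L k i) * L k j))"
  using assms
proof (induction m arbitrary: h)
  case 0
  then show ?case by auto
next
  case (Suc m)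
  note herm = Suc.prems(1) and pos = Suc.prems(2)
  have "(\<Sum>i<Suc m. \<Sum>j<Suc m. h i j * (if j = m then 1 else 0) * cnj (if i = m then 1 else 0)) = h m m"
    by simp
  then have hmm: "0 < h m m" using pos[of "\<lambda>i. if i = m then 1 else 0"] by simp
  define s where "s = complex_of_real (sqrt (Re (h m m)))"
  have s: "s * s = h m m" "s \<noteq> 0" "cnj s = s"
    using hmm unfolding s_def less_complex_def
    by (auto simp: complex_eq_iff simp flip: of_real_mult)
  define l where "l j = (if j \<le> m then h m j / s else 0)" for j
  define g where "g i j = h i j - cnj (l i) * l j" for i j
  have lm: "l m = s" unfolding l_def s(1)[symmetric] using s(2) by simp
  have g0: "g i m = 0" "g m i = 0" if "i \<le> m" for i
  proof -
    show "g m i = 0" unfolding g_def lm s(3) using that s(2) unfolding l_def by simp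
    have "h i m = cnj (h m i)" using herm[of i m] that by simp
    then show "g i m = 0" unfolding g_def lm using that s(2,3) unfolding l_def by simp
  qed
  have "\<exists>L. (\<forall>k<m. L k k \<noteq> 0) \<and> (\<forall>k<m. \<forall>j>k. L k j = 0) \<and>
    (\<forall>i<m. \<forall>j<m. g i j = (\<Sum>k<m. cnj (L k i) * L k j))"
  proof (rule Suc.IH)
    fix i j assume "i < m" "j < m"
    then show "g i j = cnj (g j i)" using herm[of i j] unfolding g_def by simp
  next
    fix x :: "nat \<Rightarrow> complex" assume x: "\<exists>i<m. x i \<noteq> 0"
    \<comment> \<open>This value of the last variable annihilates the linear form \<open>l\<close>.\<close>
    define y where "y = x(m := - (\<Sum>j<m. l j * x j) / s)"
    have ly: "(\<Sum>j<Suc m. l j * y j) = 0" unfolding y_def using s(2) lm by simp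
    have split: "h i j * y j * cnj (y i) = g i j * y j * cnj (y i) + cnj (l i * y i) * (l j * y j)" for i j
    proof -
      have "h i j = g i j + cnj (l i) * l j" unfolding g_def by simp
      then show ?thesis by (simp only: distrib_right distrib_left complex_cnj_mult mult_ac)
    qed
    have "(\<Sum>i<Suc m. \<Sum>j<Suc m. h i j * y j * cnj (y i))
      = (\<Sum>i<Suc m. \<Sum>j<Suc m. g i j * y j * cnj (y i))
        + (\<Sum>i<Suc m. \<Sum>j<Suc m. cnj (l i * y i) * (l j * y j))"
      by (simp only: split sum.distrib)
    also have "(\<Sum>i<Suc m. \<Sum>j<Suc m. cnj (l i * y i) * (l j * y j)) = 0"
      unfolding sum_product[symmetric] ly by simp
    also have "(\<Sum>i<Suc m. \<Sum>j<Suc m. g i j * y j * cnj (y i)) = (\<Sum>i<m. \<Sum>j<m. g i j * y j * cnj (y i))"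
      by (simp add: g0)
    also have "\<dots> = (\<Sum>i<m. \<Sum>j<m. g i j * x j * cnj (x i))" unfolding y_def by simp
    finally have "(\<Sum>i<Suc m. \<Sum>j<Suc m. h i j * y j * cnj (y i)) = (\<Sum>i<m. \<Sum>j<m. g i j * x j * cnj (x i))"
      by simp
    moreover have "\<exists>i<Suc m. y i \<noteq> 0" using x unfolding y_def by (auto intro: less_SucI)
    ultimately show "0 < (\<Sum>i<m. \<Sum>j<m. g i j * x j * cnj (x i))" using pos[of y] by simp
  qed
  then obtain L where L: "\<forall>k<m. L k k \<noteq> 0" "\<forall>k<m. \<forall>j>k. L k j = 0"
    "\<forall>i<m. \<forall>j<m. g i j = (\<Sum>k<m. cnj (L k i) * L k j)"
    by (elim exE conjE) (rule that)
  have gL: "g i j = (\<Sum>k<m. cnj (L k i) * L k j)" if "i < Suc m" "j < Suc m" for i j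
  proof (cases "i = m \<or> j = m")
    case True
    then have "g i j = 0" using that g0 by (auto simp: less_Suc_eq_le)
    moreover have "(\<Sum>k<m. cnj (L k i) * L k j) = 0" using True that L(2) by (intro sum.neutral) (auto simp: less_Suc_eq)
    ultimately show ?thesis by simp
  next
    case False
    then show ?thesis using that L(3) by simp
  qed
  show ?case
  proof (intro exI[of _ "\<lambda>k. if k = m then l else L k"] conjI allI impI)
    fix i j assume ij: "i < Suc m" "j < Suc m"
    have "(\<Sum>k<m. cnj ((if k = m then l else L k) i) * (if k = m then l else L k) j) = g i j"
      unfolding gL[OF ij] by (intro sum.cong refl) simp
    then show "h i j = (\<Sum>k<Suc m. cnj ((if k = m then l else L k) i) * (if k = m then l else L k) j)"
      unfolding sum.lessThan_Suc g_def by simp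
  next
    fix k assume "k < Suc m"
    then show "(if k = m then l else L k) k \<noteq> 0" using L(1) lm s(2) by (cases "k = m") simp_all
  next
    fix k j assume "k < Suc m" "k < j"
    then show "(if k = m then l else L k) j = 0"
      using L(2) by (cases "k = m") (simp_all add: l_def)
  qed
qed

text \<open>Row \<open>k\<close> of a triangular factor with nonzero diagonal holds the coefficients of a polynomial
of degree exactly \<open>k\<close>.\<close>

lemma pos_def_charpoly_sum_squares:
  assumes coeff: "is_coeff_matrix n p H" and pd: "pos_def_mat H"
  shows "\<exists>q :: nat \<Rightarrow> complex poly. (\<forall>i\<le>n. q i \<noteq> 0 \<and> degree (q i) = i) \<and>
    (\<forall>\<mu>. p \<mu> = (\<Sum>i\<le>n. complex_of_real ((cmod (poly (q i) \<mu>))\<^sup>2)))"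
proof -
  have H: "H \<in> carrier_mat (n + 1) (n + 1)"
    and p: "\<And>\<mu>. p \<mu> = (\<Sum>i\<le>n. \<Sum>j\<le>n. H $$ (i, j) * \<mu> ^ j * cnj \<mu> ^ i)"
    using coeff unfolding is_coeff_matrix_def by auto
  have herm: "hermitian_mat H" using pd unfolding pos_def_mat_def by blast
  have "\<exists>L. (\<forall>k<n + 1. L k k \<noteq> 0) \<and> (\<forall>k<n + 1. \<forall>j>k. L k j = 0) \<and>
    (\<forall>i<n + 1. \<forall>j<n + 1. H $$ (i, j) = (\<Sum>k<n + 1. cnj (L k i) * L k j))"
  proof (rule positive_form_triangular_factorization)
    show "H $$ (i, j) = cnj (H $$ (j, i))" if "i < n + 1" "j < n + 1" for i j
      by (rule hermitian_index[OF herm H that])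
    fix x :: "nat \<Rightarrow> complex" assume x: "\<exists>i<n + 1. x i \<noteq> 0"
    let ?v = "vec (n + 1) x"
    have "?v \<noteq> 0\<^sub>v (n + 1)"
    proof
      assume z: "?v = 0\<^sub>v (n + 1)"
      obtain i where "i < n + 1" "x i \<noteq> 0" using x by blast
      then show False using arg_cong[OF z, of "\<lambda>v. v $ i"] by simp
    qed
    then have "0 < (H *\<^sub>v ?v) \<bullet>c ?v" using pd H unfolding pos_def_mat_def by auto
    also have "(H *\<^sub>v ?v) \<bullet>c ?v = (\<Sum>i<n + 1. \<Sum>j<n + 1. H $$ (i, j) * x j * cnj (x i))"
      using H by (simp add: scalar_prod_def lessThan_atLeast0 sum_distrib_right distrib_right
          del: sum.atLeast0_lessThan_Suc sum.lessThan_Suc sum.op_ivl_Suc)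
    finally show "0 < (\<Sum>i<n + 1. \<Sum>j<n + 1. H $$ (i, j) * x j * cnj (x i))" .
  qed
  then obtain L where L0: "\<forall>k\<le>n. L k k \<noteq> 0" "\<forall>k\<le>n. \<forall>j>k. L k j = 0"
    "\<forall>i\<le>n. \<forall>j\<le>n. H $$ (i, j) = (\<Sum>k\<le>n. cnj (L k i) * L k j)"
    unfolding Suc_eq_plus1[symmetric] less_Suc_eq_le lessThan_Suc_atMost
    by (elim exE conjE) (rule that)
  then have L: "\<And>k. k \<le> n \<Longrightarrow> L k k \<noteq> 0" "\<And>k j. k \<le> n \<Longrightarrow> k < j \<Longrightarrow> L k j = 0"
    "\<And>i j. i \<le> n \<Longrightarrow> j \<le> n \<Longrightarrow> H $$ (i, j) = (\<Sum>k\<le>n. 1 * (cnj (L k i) * L k j))"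
    by simp_all
  define q where "q k = (\<Sum>j\<le>n. monom (L k j) j)" for k
  have coeff_q: "coeff (q k) j = (if j \<le> n then L k j else 0)" for k j
    unfolding q_def by (simp add: coeff_sum)
  have q: "q k \<noteq> 0 \<and> degree (q k) = k" if k: "k \<le> n" for k
  proof
    show "q k \<noteq> 0" using coeff_q[of k k] L(1)[OF k] k by auto
    show "degree (q k) = k"
      using coeff_q[of k] L(1)[OF k] L(2)[OF k] k
      by (intro antisym degree_le le_degree) auto
  qed
  have "p \<mu> = (\<Sum>i\<le>n. complex_of_real ((cmod (poly (q i) \<mu>))\<^sup>2))" for \<mu>
  proof -
    have "poly (q k) \<mu> = (\<Sum>j\<le>n. L k j * \<mu> ^ j)" for k
      unfolding q_def by (simp add: poly_sum poly_monom)
    moreover have "p \<mu> = (\<Sum>k\<le>n. 1 * complex_of_real ((cmod (\<Sum>j\<le>n. L k j * \<mu> ^ j))\<^sup>2))"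
      unfolding p by (rule quadratic_form_eq_sum_squares) (rule L(3))
    ultimately show ?thesis by (simp only: mult_1)
  qed
  then show ?thesis using q by blast
qed

section \<open>Zeros on the real axis\<close>

text \<open>For real $t$ the shift by $t$ and its conjugate agree, so the block matrix of $R-t$ is
$R^{\mathbb C}-t$. The sign between $\det(A-t)$ and $\det(t-A)$ disappears in the even dimension
$2n$.\<close>

lemma op_charpoly_real_eq_char_poly:
  assumes rep: "represents n R C B"
  shows "op_charpoly n R (complex_of_real t) = poly (char_poly (complexification n R)) (complex_of_real t)"
proof -
  let ?A = "complexification n R" and ?t = "complex_of_real t"
  have A: "?A = four_block_mat C B (map_mat cnj B) (map_mat cnj C)"
    unfolding complexification_def parts_eqI[OF rep] Let_def ..
  have c: "C \<in> carrier_mat n n" "B \<in> carrier_mat n n" using rep unfolding represents_def by auto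
  have Ac: "?A \<in> carrier_mat (n + n) (n + n)" unfolding A using c by auto
  have "poly (char_poly ?A) ?t = det ((- 1) \<cdot>\<^sub>m char_matrix ?A ?t)"
    unfolding char_poly_matrix[OF Ac]
    by (rule arg_cong[of _ _ det]) (intro eq_matI, auto)
  also have "\<dots> = (- 1) ^ (n + n) * det (char_matrix ?A ?t)"
    using char_matrix_closed[OF Ac, of ?t] by simp
  also have "\<dots> = det (char_matrix ?A ?t)" by (simp add: power_add flip: power_mult_distrib)
  also have "char_matrix ?A ?t = four_block_mat (C - ?t \<cdot>\<^sub>m 1\<^sub>m n) B (map_mat cnj B)
      (map_mat cnj (C - ?t \<cdot>\<^sub>m 1\<^sub>m n))"
    unfolding A char_matrix_def using c by (intro eq_matI) auto
  finally show ?thesis unfolding op_charpoly_eq[OF rep] ..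
qed

text \<open>The real parts of the coefficients of the characteristic polynomial of $R^{\mathbb C}$ form
a real polynomial \<open>r\<close>, still monic, that agrees with $p$ on the real axis because $p$ is real
valued.\<close>

lemma op_charpoly_zero_if_det_nonpos:
  assumes rep: "represents n R C B" and d: "det (complexification n R) \<le> 0"
  shows "\<exists>\<mu>. op_charpoly n R \<mu> = 0"
proof -
  let ?q = "char_poly (complexification n R)"
  define r where "r = map_poly Re ?q"
  have c: "C \<in> carrier_mat n n" "B \<in> carrier_mat n n" using rep unfolding represents_def by auto
  have "complexification n R \<in> carrier_mat (n + n) (n + n)"
    unfolding complexification_def parts_eqI[OF rep] Let_def using c by auto
  from degree_monic_char_poly[OF this]
  have dq: "degree ?q = n + n" "coeff ?q (n + n) = 1" by auto
  have coeff_r: "coeff r k = Re (coeff ?q k)" for k unfolding r_def by (simp add: coeff_map_poly)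
  have dr: "degree r \<le> n + n" using dq coeff_r by (intro degree_le) (auto simp: coeff_eq_0)
  have lr: "lead_coeff r = 1"
  proof -
    have "degree r = n + n" using dr coeff_r[of "n + n"] dq by (intro antisym le_degree) auto
    then show ?thesis using coeff_r dq by simp
  qed
  have r: "op_charpoly n R (complex_of_real t) = complex_of_real (poly r t)" for t
  proof -
    have "Re (poly ?q (complex_of_real t)) = (\<Sum>k\<le>n + n. Re (coeff ?q k * complex_of_real (t ^ k)))"
      unfolding poly_altdef dq by simp
    also have "\<dots> = (\<Sum>k\<le>n + n. coeff r k * t ^ k)"
      unfolding coeff_r by (simp only: Re_complex_of_real times_complex.sel Im_complex_of_real) simp
    also have "\<dots> = poly r t"
      using arg_cong[OF poly_as_sum_of_monoms'[OF dr], of "\<lambda>q. poly q t"]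
      by (simp add: poly_sum poly_monom)
    finally have "Re (op_charpoly n R (complex_of_real t)) = poly r t"
      unfolding op_charpoly_real_eq_char_poly[OF rep] .
    then show ?thesis using op_charpoly_real[OF rep, of "complex_of_real t"]
      by (metis of_real_Re)
  qed
  have "op_charpoly n R 0 = det (complexification n R)"
  proof -
    have "C - 0 \<cdot>\<^sub>m 1\<^sub>m n = C" using c by (intro eq_matI) auto
    then show ?thesis
      unfolding op_charpoly_eq[OF rep] complexification_def parts_eqI[OF rep] Let_def by simp
  qed
  then have r0: "poly r 0 \<le> 0" using d r[of 0] by (simp add: less_eq_complex_def)
  obtain b where b: "\<And>x. x \<ge> b \<Longrightarrow> poly r x \<ge> 1" using poly_pinfty_gt_lc[of r] lr by auto
  have "\<exists>t. poly r t = 0"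
  proof (cases "poly r 0 = 0")
    case False
    then have "poly r 0 < 0" "0 < poly r (max b 1)" using r0 b[of "max b 1"] by auto
    moreover have "0 < max b 1" by simp
    ultimately show ?thesis using poly_IVT_pos[of 0 "max b 1" r] by blast
  qed blast
  then show ?thesis using r by (metis of_real_0)
qed

section \<open>The properties of the characteristic polynomial\<close>

theorem theorem4p2:
  fixes n :: nat and R :: "complex vec \<Rightarrow> complex vec"
  assumes "n \<ge> 1" and "real_linear_op n R"
  shows
    "(\<forall>\<mu>. op_charpoly n R \<mu> \<in> \<real>)
     \<and> hermitian_mat (charpoly_coeffs n R)
     \<and> (\<forall>U \<in> carrier_mat (n + 1) (n + 1).
          unitary_mat U \<and> diagonal_mat (U * charpoly_coeffs n R * mat_adjoint U) \<longrightarrow>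
            (\<exists>d :: nat \<Rightarrow> real. \<forall>\<mu>. op_charpoly n R \<mu> =
               (\<Sum>i\<le>n. complex_of_real (d i * (cmod (poly (row_poly U i) \<mu>))\<^sup>2)))
            \<and> \<not> (\<exists>\<mu>. \<forall>i\<le>n. poly (row_poly U i) \<mu> = 0))
     \<and> (pos_def_mat (charpoly_coeffs n R) \<longrightarrow>
          (\<exists>q :: nat \<Rightarrow> complex poly.
             (\<forall>i\<le>n. q i \<noteq> 0 \<and> degree (q i) = i)
             \<and> (\<forall>\<mu>. op_charpoly n R \<mu> =
                  (\<Sum>i\<le>n. complex_of_real ((cmod (poly (q i) \<mu>))\<^sup>2)))
             \<and> \<not> (\<exists>\<mu>. \<forall>i\<le>n. poly (q i) \<mu> = 0))
          \<and> op_spectrum n R = {})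
     \<and> (det (complexification n R) \<le> 0 \<longrightarrow>
          (\<exists>\<mu>. op_charpoly n R \<mu> = 0) \<and> op_spectrum n R \<noteq> {})
     \<and> (\<forall>\<mu>. op_charpoly n (op_adjoint n R) \<mu> = op_charpoly n R (cnj \<mu>))
     \<and> charpoly_coeffs n (op_adjoint n R) = map_mat cnj (charpoly_coeffs n R)
     \<and> ((\<forall>x \<in> carrier_vec n. op_adjoint n R x = R x) \<longrightarrow>
          (\<forall>i\<le>n. \<forall>j\<le>n. charpoly_coeffs n R $$ (i, j) \<in> \<real>))"
proof -
  let ?H = "charpoly_coeffs n R"
  obtain C B where rep: "represents n R C B" using represents_ex[OF assms(2)] by blast
  have coeff: "is_coeff_matrix n (op_charpoly n R) ?H" by (rule charpoly_coeffs[OF assms(2)])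
  then have H: "?H \<in> carrier_mat (n + 1) (n + 1)"
    and p: "\<And>\<mu>. op_charpoly n R \<mu> = (\<Sum>i\<le>n. \<Sum>j\<le>n. ?H $$ (i, j) * \<mu> ^ j * cnj \<mu> ^ i)"
    unfolding is_coeff_matrix_def by auto
  have real: "op_charpoly n R \<mu> \<in> \<real>" for \<mu> by (rule op_charpoly_real[OF rep])
  have herm: "hermitian_mat ?H" by (rule hermitian_coeff_matrix[OF coeff real])
  have diag: "(\<exists>d :: nat \<Rightarrow> real. \<forall>\<mu>. op_charpoly n R \<mu> =
        (\<Sum>i\<le>n. complex_of_real (d i * (cmod (poly (row_poly U i) \<mu>))\<^sup>2)))
      \<and> \<not> (\<exists>\<mu>. \<forall>i\<le>n. poly (row_poly U i) \<mu> = 0)"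
    if U: "U \<in> carrier_mat (n + 1) (n + 1)" "unitary_mat U"
      and D: "diagonal_mat (U * ?H * mat_adjoint U)" for U
  proof
    let ?D = "U * ?H * mat_adjoint U"
    have h: "?H $$ (i, j) = (\<Sum>k\<le>n. ?D $$ (k, k) * (cnj (U $$ (k, i)) * U $$ (k, j)))"
      if "i \<le> n" "j \<le> n" for i j
      using unitary_diagonalization_index[OF U H D, of i j] that
      by (simp only: Suc_eq_plus1[symmetric] lessThan_Suc_atMost less_Suc_eq_le)
    have row: "poly (row_poly U k) \<mu> = (\<Sum>j\<le>n. U $$ (k, j) * \<mu> ^ j)" for k \<mu>
      using U(1) by (simp only: poly_row_poly carrier_matD Suc_eq_plus1[symmetric] lessThan_Suc_atMost)
    have sum: "op_charpoly n R \<mu> =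
        (\<Sum>k\<le>n. ?D $$ (k, k) * complex_of_real ((cmod (poly (row_poly U k) \<mu>))\<^sup>2))" for \<mu>
      unfolding p row by (rule quadratic_form_eq_sum_squares[OF h])
    \<comment> \<open>As \<open>p\<close> is real valued, the weights can be replaced by their real parts.\<close>
    have "op_charpoly n R \<mu> =
        (\<Sum>k\<le>n. complex_of_real (Re (?D $$ (k, k)) * (cmod (poly (row_poly U k) \<mu>))\<^sup>2))" for \<mu>
    proof -
      have "op_charpoly n R \<mu> = complex_of_real (Re (op_charpoly n R \<mu>))"
        using real[of \<mu>] by simp
      also have "Re (op_charpoly n R \<mu>) = (\<Sum>k\<le>n. Re (?D $$ (k, k)) * (cmod (poly (row_poly U k) \<mu>))\<^sup>2)"
        unfolding sum Re_sum by (intro sum.cong refl) (simp only: times_complex.sel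
          Re_complex_of_real Im_complex_of_real mult_zero_right diff_zero)
      finally show ?thesis by simp
    qed
    then show "\<exists>d :: nat \<Rightarrow> real. \<forall>\<mu>. op_charpoly n R \<mu> =
        (\<Sum>i\<le>n. complex_of_real (d i * (cmod (poly (row_poly U i) \<mu>))\<^sup>2))"
      by (intro exI[of _ "\<lambda>k. Re (?D $$ (k, k))"] allI)
    show "\<not> (\<exists>\<mu>. \<forall>i\<le>n. poly (row_poly U i) \<mu> = 0)"
      by (rule unitary_row_polys_no_common_zero[OF U])
  qed
  have pd: "(\<exists>q :: nat \<Rightarrow> complex poly.
             (\<forall>i\<le>n. q i \<noteq> 0 \<and> degree (q i) = i)
             \<and> (\<forall>\<mu>. op_charpoly n R \<mu> =
                  (\<Sum>i\<le>n. complex_of_real ((cmod (poly (q i) \<mu>))\<^sup>2)))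
             \<and> \<not> (\<exists>\<mu>. \<forall>i\<le>n. poly (q i) \<mu> = 0))
          \<and> op_spectrum n R = {}" if posdef: "pos_def_mat ?H"
  proof -
    obtain q :: "nat \<Rightarrow> complex poly" where q: "\<forall>i\<le>n. q i \<noteq> 0 \<and> degree (q i) = i"
      and sum: "\<forall>\<mu>. op_charpoly n R \<mu> = (\<Sum>i\<le>n. complex_of_real ((cmod (poly (q i) \<mu>))\<^sup>2))"
      using pos_def_charpoly_sum_squares[OF coeff posdef] by blast
    obtain a where a: "q 0 = [:a:]" using q by (meson degree_eq_zeroE le0)
    then have "a \<noteq> 0" using q by force
    then have nz: "poly (q 0) \<mu> \<noteq> 0" for \<mu> using a by simp
    have "op_charpoly n R \<mu> \<noteq> 0" for \<mu>
    proof
      assume "op_charpoly n R \<mu> = 0"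
      then have "(\<Sum>i\<le>n. (cmod (poly (q i) \<mu>))\<^sup>2) = 0"
        using sum by (metis of_real_eq_0_iff of_real_sum)
      then show False using nz[of \<mu>] by (subst (asm) sum_nonneg_eq_0_iff) auto
    qed
    then have "op_spectrum n R = {}" using op_spectrum_iff[OF rep] by auto
    then show ?thesis using q sum nz by blast
  qed
  have spec: "(\<exists>\<mu>. op_charpoly n R \<mu> = 0) \<and> op_spectrum n R \<noteq> {}"
    if "det (complexification n R) \<le> 0"
    using op_charpoly_zero_if_det_nonpos[OF rep that] op_spectrum_iff[OF rep] by auto
  have adj: "op_charpoly n (op_adjoint n R) \<mu> = op_charpoly n R (cnj \<mu>)" for \<mu>
    by (rule op_charpoly_adjoint[OF rep])
  have Hc: "map_mat cnj ?H = transpose_mat ?H"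
  proof (rule eq_matI)
    fix i j assume "i < dim_row (transpose_mat ?H)" "j < dim_col (transpose_mat ?H)"
    then have "i < n + 1" "j < n + 1" using H by auto
    then show "map_mat cnj ?H $$ (i, j) = transpose_mat ?H $$ (i, j)"
      using H hermitian_index[OF herm H, of j i] by simp
  qed (use H in auto)
  have coeff': "is_coeff_matrix n (op_charpoly n (op_adjoint n R)) (map_mat cnj ?H)"
    using is_coeff_matrix_transpose[OF coeff] unfolding adj[symmetric] Hc .
  have coeff_adj: "charpoly_coeffs n (op_adjoint n R) = map_mat cnj ?H"
    unfolding charpoly_coeffs_def[of n "op_adjoint n R"]
    using coeff' coeff_matrix_unique by (intro the_equality) blast+
  have sa: "?H $$ (i, j) \<in> \<real>"
    if eq: "\<forall>x \<in> carrier_vec n. op_adjoint n R x = R x" and ij: "i \<le> n" "j \<le> n" for i j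
  proof -
    have "represents n (op_adjoint n R) C B" using rep eq unfolding represents_def by simp
    then have "op_charpoly n (op_adjoint n R) = op_charpoly n R"
      using op_charpoly_eq[of n "op_adjoint n R" C B] op_charpoly_eq[OF rep] by auto
    then have "map_mat cnj ?H = ?H" using coeff_matrix_unique[OF coeff' ] coeff by simp
    then have "cnj (?H $$ (i, j)) = ?H $$ (i, j)"
      using H ij index_map_mat(1)[of i ?H j cnj] by simp
    then show ?thesis by (simp add: Reals_cnj_iff)
  qed
  show ?thesis using real herm diag pd spec adj coeff_adj sa by blast
qed

end
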